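(* (i) For every integer $n\geq 5$, $ar(n,\mathcal{T})=\lfloor n/3\rfloor+2$. (ii) $ar(6,\mathcal{M})=11$ and $ar(n,\mathcal{M})=3$ for every $n\geq 7$. (iii) For every integer $n\geq 7$, $ar(n,\mathcal{L})=n$.
   Context: For a 3-graph $G$ and $n\geq |V(G)|$, the anti-Ramsey number $ar(n,G)$ is the minimum integer $k$ such that every edge-coloring of the complete 3-uniform hypergraph $K^{(3)}_n$ using at least $k$ colors contains a rainbow copy of $G$ (a copy all of whose edges have distinct colors). The tight path $\mathcal{T}$ has edges $\{v_1v_2v_3,v_2v_3v_4,v_3v_4v_5\}$; the messy path $\mathcal{M}$ has edges $\{v_1v_2v_3,v_2v_3v_4,v_4v_5v_6\}$; the loose path $\mathcal{L}$ has edges $\{v_1v_2v_3,v_3v_4v_5,v_5v_6v_7\}$ (all $v_i$ distinct). *)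

theory Defs
  imports Main
begin

type_synonym 'a hypergraph = "'a set \<times> 'a set set"

abbreviation verts :: "'a hypergraph \<Rightarrow> 'a set" where
  "verts G \<equiv> fst G"

abbreviation hedges :: "'a hypergraph \<Rightarrow> 'a set set" where
  "hedges G \<equiv> snd G"

definition three_graph :: "'a hypergraph \<Rightarrow> bool" where
  "three_graph G \<longleftrightarrow>
     finite (verts G) \<and> (\<forall>e\<in>hedges G. e \<subseteq> verts G \<and> card e = 3)"

definition complete_three_graph :: "nat \<Rightarrow> nat hypergraph" where
  "complete_three_graph n = ({..<n}, {e. e \<subseteq> {..<n} \<and> card e = 3})"

definition is_copy_in :: "'b hypergraph \<Rightarrow> 'a hypergraph \<Rightarrow> 'b hypergraph \<Rightarrow> bool" where
  "is_copy_in C G H \<longleftrightarrow>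
     verts C \<subseteq> verts H \<and> hedges C \<subseteq> hedges H \<and>
     (\<exists>f. inj_on f (verts G) \<and> verts C = f ` verts G \<and>
          hedges C = (\<lambda>e. f ` e) ` hedges G)"

definition rainbow :: "('b set \<Rightarrow> 'c) \<Rightarrow> 'b hypergraph \<Rightarrow> bool" where
  "rainbow c C \<longleftrightarrow> inj_on c (hedges C)"

text \<open>
  A colouring is a function on all sets of vertices, but only its values on the edges matter:
  the colours used are \<open>c ` hedges K\<close>. Since there are finitely many edges, taking natural
  numbers as colours is no restriction.
\<close>

definition forces_rainbow :: "nat \<Rightarrow> 'a hypergraph \<Rightarrow> nat \<Rightarrow> bool" where
  "forces_rainbow n G k \<longleftrightarrow>
     (\<forall>c :: nat set \<Rightarrow> nat.
        k \<le> card (c ` hedges (complete_three_graph n)) \<longrightarrow>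
        (\<exists>C. is_copy_in C G (complete_three_graph n) \<and> rainbow c C))"

definition ar :: "nat \<Rightarrow> 'a hypergraph \<Rightarrow> nat" where
  "ar n G = (LEAST k. forces_rainbow n G k)"

definition tight_path :: "nat hypergraph" where
  "tight_path = ({1..5}, {{1,2,3}, {2,3,4}, {3,4,5}})"

definition messy_path :: "nat hypergraph" where
  "messy_path = ({1..6}, {{1,2,3}, {2,3,4}, {4,5,6}})"

definition loose_path :: "nat hypergraph" where
  "loose_path = ({1..7}, {{1,2,3}, {3,4,5}, {5,6,7}})"

lemma three_graph_paths:
  "three_graph tight_path" "three_graph messy_path" "three_graph loose_path"
  by (auto simp: three_graph_def tight_path_def messy_path_def loose_path_def)

text \<open>The minimum in the definition of \<open>ar\<close> is always attained.\<close>

lemma forces_rainbow_ar: "forces_rainbow n G (ar n G)"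
proof -
  let ?E = "hedges (complete_three_graph n)"
  have "finite ?E"
    by (rule finite_subset[of _ "Pow {..<n}"]) (auto simp: complete_three_graph_def)
  then have "card (c ` ?E) < Suc (card ?E)" for c :: "nat set \<Rightarrow> nat"
    by (simp add: card_image_le le_imp_less_Suc)
  then have "forces_rainbow n G (Suc (card ?E))"
    unfolding forces_rainbow_def by (meson leD)
  then show ?thesis
    unfolding ar_def by (rule LeastI)
qed

end

theory Submission
  imports Defs
begin

text \<open>
  Tight path: every 5-set of vertices of a rainbow-free colouring carries at most two colours. Adding
  the vertices one at a time, this yields a colour \<open>z\<close> such that edges of distinct colours other than
  \<open>z\<close> are disjoint, so there are at most \<open>n div 3\<close> colours besides \<open>z\<close>.

  Messy path: if two disjoint edges have different colours, then every other edge inside their union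
  completes a messy path with them, so the six vertices carry only two colours. For \<open>n \<ge> 7\<close> disjointness
  connects all triples, so in a non-constant colouring such a pair exists, and a third colour cannot
  appear when the 6-set is enlarged vertex by vertex.

  Loose path: fix disjoint edges \<open>e\<close>, \<open>f\<close> of different colours. An edge of a third colour meets one of
  them in two vertices, and this is the same one, say \<open>e\<close>, for all such edges. Representatives of two
  such colours have the same trace on \<open>e\<close> or the same vertex outside \<open>e\<close>, which leaves at most
  \<open>n - 3\<close> further colours.
\<close>

subsection \<open>Triples and rainbow copies\<close>

definition triples :: "'a set \<Rightarrow> 'a set set" where
  "triples V = {e. e \<subseteq> V \<and> card e = 3}"

lemma hedges_complete: "hedges (complete_three_graph n) = triples {..<n}"
  by (simp add: complete_three_graph_def triples_def)

lemma triplesD: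
  assumes "e \<in> triples V"
  shows "e \<subseteq> V" "card e = 3" "finite e"
  using assms by (auto simp: triples_def card_ge_0_finite)

lemma triplesI: "\<lbrakk>distinct [a, b, d]; {a, b, d} \<subseteq> V\<rbrakk> \<Longrightarrow> {a, b, d} \<in> triples V"
  by (auto simp: triples_def)

lemma triples_mono: "X \<subseteq> V \<Longrightarrow> triples X \<subseteq> triples V"
  by (auto simp: triples_def)

lemma finite_triples: "finite V \<Longrightarrow> finite (triples V)"
  by (rule finite_subset[of _ "Pow V"]) (auto simp: triples_def)

lemma triple_memE:
  assumes "e \<in> triples V" "a \<in> e"
  obtains b d where "e = {a, b, d}" "distinct [a, b, d]"
proof -
  have "card (e - {a}) = 2"
    using assms triplesD[OF assms(1)] by simp
  then obtain b d where "e - {a} = {b, d}" "b \<noteq> d"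
    by (auto simp: card_2_iff)
  with assms(2) have "e = {a, b, d}" "distinct [a, b, d]"
    by auto
  then show thesis by (rule that)
qed

lemma tripleE:
  assumes "e \<in> triples V"
  obtains a b d where "e = {a, b, d}" "distinct [a, b, d]"
proof -
  have "e \<noteq> {}" using triplesD[OF assms] by auto
  then show thesis using triple_memE[OF assms] that by blast
qed

lemma triple_supersetE:
  assumes "S \<subseteq> V" "finite V" "card S \<le> 3" "card V \<ge> 3"
  obtains e where "e \<in> triples V" "S \<subseteq> e"
proof -
  obtain e where "S \<subseteq> e" "e \<subseteq> V" "card e = 3"
    using exists_subset_between[of S 3 V] assms by auto
  then show thesis using that by (auto simp: triples_def)
qed

text \<open>The edges are subsets of \<open>verts G\<close>, so taking images under an injective
  \<open>f\<close> is injective on them. A copy is therefore rainbow exactly when \<open>c\<close>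
  of the image is injective on the edges of \<open>G\<close>, and only the embedding has to be
  mentioned.\<close>

lemma rainbow_copy_iff:
  assumes "three_graph G"
  shows "(\<exists>C. is_copy_in C G (complete_three_graph n) \<and> rainbow c C) \<longleftrightarrow>
    (\<exists>f. inj_on f (verts G) \<and> f ` verts G \<subseteq> {..<n} \<and> inj_on (\<lambda>e. c (f ` e)) (hedges G))"
proof -
  have inj: "inj_on ((`) f) (hedges G)" if "inj_on f (verts G)" for f :: "'a \<Rightarrow> nat"
    using inj_on_image_Pow[OF that] assms by (auto simp: three_graph_def intro: inj_on_subset)
  have iff: "inj_on c ((`) f ` hedges G) \<longleftrightarrow> inj_on (\<lambda>e. c (f ` e)) (hedges G)"
    if "inj_on f (verts G)" for f
    using comp_inj_on_iff[OF inj[OF that], of c] by (simp add: comp_def)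
  show ?thesis
  proof
    assume "\<exists>C. is_copy_in C G (complete_three_graph n) \<and> rainbow c C"
    then obtain C f where C: "verts C \<subseteq> {..<n}" "inj_on c (hedges C)"
      "inj_on f (verts G)" "verts C = f ` verts G" "hedges C = (`) f ` hedges G"
      by (auto simp: is_copy_in_def rainbow_def complete_three_graph_def)
    then show "\<exists>f. inj_on f (verts G) \<and> f ` verts G \<subseteq> {..<n} \<and> inj_on (\<lambda>e. c (f ` e)) (hedges G)"
      using iff[OF C(3)] by (intro exI[of _ f]) auto
  next
    assume "\<exists>f. inj_on f (verts G) \<and> f ` verts G \<subseteq> {..<n} \<and> inj_on (\<lambda>e. c (f ` e)) (hedges G)"
    then obtain f where f: "inj_on f (verts G)" "f ` verts G \<subseteq> {..<n}"
      "inj_on (\<lambda>e. c (f ` e)) (hedges G)" by blast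
    have "f ` e \<in> triples {..<n}" if "e \<in> hedges G" for e
    proof -
      have "e \<subseteq> verts G" "card e = 3" using that assms by (auto simp: three_graph_def)
      moreover from this have "card (f ` e) = 3"
        using card_image[OF inj_on_subset[OF f(1)]] by simp
      ultimately show ?thesis using f(2) by (auto simp: triples_def)
    qed
    then have "is_copy_in (f ` verts G, (`) f ` hedges G) G (complete_three_graph n)"
      using f unfolding is_copy_in_def hedges_complete by (auto simp: complete_three_graph_def)
    moreover have "rainbow c (f ` verts G, (`) f ` hedges G)"
      using iff[OF f(1)] f(3) by (simp add: rainbow_def)
    ultimately show "\<exists>C. is_copy_in C G (complete_three_graph n) \<and> rainbow c C" by blast
  qed
qed

text \<open>The first assumption says that \<open>Suc k\<close> forces a rainbow copy. The colouring
  \<open>c0\<close> defeats every \<open>j\<close> up to its own number of colours, in particular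
  every \<open>j \<le> k\<close>.\<close>

lemma ar_eqI:
  assumes "\<And>c :: nat set \<Rightarrow> nat. k < card (c ` triples {..<n}) \<Longrightarrow>
      \<exists>C. is_copy_in C G (complete_three_graph n) \<and> rainbow c C"
    and "k \<le> card (c0 ` triples {..<n})"
    and "\<not> (\<exists>C. is_copy_in C G (complete_three_graph n) \<and> rainbow (c0 :: nat set \<Rightarrow> nat) C)"
  shows "ar n G = Suc k"
  unfolding ar_def
proof (rule Least_equality)
  show "forces_rainbow n G (Suc k)"
    unfolding forces_rainbow_def hedges_complete using assms(1) by auto
next
  fix j assume "forces_rainbow n G j"
  then have "\<not> j \<le> card (c0 ` triples {..<n})"
    unfolding forces_rainbow_def hedges_complete using assms(3) by blast
  then show "Suc k \<le> j" using assms(2) by simp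
qed

section \<open>Rainbow-free colourings in terms of vertex sequences\<close>

definition tight_free :: "('a set \<Rightarrow> 'c) \<Rightarrow> 'a set \<Rightarrow> bool" where
  "tight_free c V \<longleftrightarrow> (\<forall>a b p q r. {a, b, p, q, r} \<subseteq> V \<and> distinct [a, b, p, q, r] \<longrightarrow>
     \<not> distinct [c {a, b, p}, c {b, p, q}, c {p, q, r}])"

definition messy_free :: "('a set \<Rightarrow> 'c) \<Rightarrow> 'a set \<Rightarrow> bool" where
  "messy_free c V \<longleftrightarrow> (\<forall>a b p q r s. {a, b, p, q, r, s} \<subseteq> V \<and> distinct [a, b, p, q, r, s] \<longrightarrow>
     \<not> distinct [c {a, b, p}, c {b, p, q}, c {q, r, s}])"

definition loose_free :: "('a set \<Rightarrow> 'c) \<Rightarrow> 'a set \<Rightarrow> bool" where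
  "loose_free c V \<longleftrightarrow> (\<forall>a b p q r s t. {a, b, p, q, r, s, t} \<subseteq> V \<and> distinct [a, b, p, q, r, s, t] \<longrightarrow>
     \<not> distinct [c {a, b, p}, c {p, q, r}, c {r, s, t}])"

lemma inj_on_set_iff: "distinct xs \<Longrightarrow> inj_on g (set xs) \<longleftrightarrow> distinct (map g xs)"
  by (simp add: distinct_map)

text \<open>An embedding of the path is determined by the tuple of its values, and injectivity on
  vertices and on edges becomes \<open>distinct\<close> of explicit lists. Later arguments can then
  work with vertices alone; the messy and the loose path are treated alike.\<close>

lemma rainbow_tight_iff:
  "(\<exists>C. is_copy_in C tight_path (complete_three_graph n) \<and> rainbow c C) \<longleftrightarrow> \<not> tight_free c {..<n}"
proof -
  have V: "{1..5} = set [1, 2, 3, 4, 5 :: nat]" by auto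
  have E: "{{1,2,3}, {2,3,4}, {3,4,5}} = set [{1,2,3}, {2,3,4}, {3,4,5} :: nat set]" by simp
  \<comment> \<open>The edges are told apart by their vertex sums 6, 9 and 12.\<close>
  have dE: "distinct [{1,2,3}, {2,3,4}, {3,4,5} :: nat set]"
    by (rule conjunct1[OF iffD1[OF distinct_map[where f = "sum id"]]]) simp
  let ?P = "\<lambda>a b p q r. {a, b, p, q, r} \<subseteq> {..<n} \<and> distinct [a, b, p, q, r] \<and>
    distinct [c {a, b, p}, c {b, p, q}, c {p, q, r}]"
  have inj_V: "inj_on f {1..5} \<longleftrightarrow> distinct [f 1, f 2, f 3, f 4, f 5]" for f :: "nat \<Rightarrow> nat"
    unfolding V by (subst inj_on_set_iff) simp_all
  have inj_E: "inj_on (\<lambda>e. c (f ` e)) {{1,2,3}, {2,3,4}, {3,4,5}} \<longleftrightarrow>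
      distinct [c {f 1, f 2, f 3}, c {f 2, f 3, f 4}, c {f 3, f 4, f 5}]" for f :: "nat \<Rightarrow> nat"
    unfolding E inj_on_set_iff[OF dE] by simp
  have img: "f ` {1..5} = {f 1, f 2, f 3, f 4, f 5}" for f :: "nat \<Rightarrow> nat"
    unfolding V by simp
  have "(\<exists>f :: nat \<Rightarrow> nat. ?P (f 1) (f 2) (f 3) (f 4) (f 5)) \<longleftrightarrow> (\<exists>a b p q r. ?P a b p q r)"
  proof
    assume "\<exists>a b p q r. ?P a b p q r"
    then obtain a b p q r where P: "?P a b p q r" by (elim exE)
    \<comment> \<open>The vertices of the path are numbered from 1, list positions from 0.\<close>
    define f where "f i = [a, b, p, q, r] ! (i - 1)" for i :: nat
    have "f 1 = a" "f 2 = b" "f 3 = p" "f 4 = q" "f 5 = r"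
      by (simp_all add: f_def numeral_eq_Suc)
    then have "?P (f 1) (f 2) (f 3) (f 4) (f 5)" using P by (simp only:)
    then show "\<exists>f :: nat \<Rightarrow> nat. ?P (f 1) (f 2) (f 3) (f 4) (f 5)" by (rule exI[of _ f])
  next
    assume "\<exists>f :: nat \<Rightarrow> nat. ?P (f 1) (f 2) (f 3) (f 4) (f 5)"
    then show "\<exists>a b p q r. ?P a b p q r" by (elim exE) (rule exI)+
  qed
  then show ?thesis
    unfolding rainbow_copy_iff[OF three_graph_paths(1)] unfolding tight_path_def fst_conv snd_conv
      inj_V inj_E img tight_free_def
    by (simp only: not_all not_imp not_not conj_ac)
qed

lemma rainbow_messy_iff:
  "(\<exists>C. is_copy_in C messy_path (complete_three_graph n) \<and> rainbow c C) \<longleftrightarrow> \<not> messy_free c {..<n}"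
proof -
  have V: "{1..6} = set [1, 2, 3, 4, 5, 6 :: nat]" by auto
  have E: "{{1,2,3}, {2,3,4}, {4,5,6}} = set [{1,2,3}, {2,3,4}, {4,5,6} :: nat set]" by simp
  \<comment> \<open>Here the vertex sums are 6, 9 and 15.\<close>
  have dE: "distinct [{1,2,3}, {2,3,4}, {4,5,6} :: nat set]"
    by (rule conjunct1[OF iffD1[OF distinct_map[where f = "sum id"]]]) simp
  let ?P = "\<lambda>a b p q r s. {a, b, p, q, r, s} \<subseteq> {..<n} \<and> distinct [a, b, p, q, r, s] \<and>
    distinct [c {a, b, p}, c {b, p, q}, c {q, r, s}]"
  have inj_V: "inj_on f {1..6} \<longleftrightarrow> distinct [f 1, f 2, f 3, f 4, f 5, f 6]" for f :: "nat \<Rightarrow> nat"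
    unfolding V by (subst inj_on_set_iff) simp_all
  have inj_E: "inj_on (\<lambda>e. c (f ` e)) {{1,2,3}, {2,3,4}, {4,5,6}} \<longleftrightarrow>
      distinct [c {f 1, f 2, f 3}, c {f 2, f 3, f 4}, c {f 4, f 5, f 6}]" for f :: "nat \<Rightarrow> nat"
    unfolding E inj_on_set_iff[OF dE] by simp
  have img: "f ` {1..6} = {f 1, f 2, f 3, f 4, f 5, f 6}" for f :: "nat \<Rightarrow> nat"
    unfolding V by simp
  have "(\<exists>f :: nat \<Rightarrow> nat. ?P (f 1) (f 2) (f 3) (f 4) (f 5) (f 6)) \<longleftrightarrow> (\<exists>a b p q r s. ?P a b p q r s)"
  proof
    assume "\<exists>a b p q r s. ?P a b p q r s"
    then obtain a b p q r s where P: "?P a b p q r s" by (elim exE)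
    define f where "f i = [a, b, p, q, r, s] ! (i - 1)" for i :: nat
    have "f 1 = a" "f 2 = b" "f 3 = p" "f 4 = q" "f 5 = r" "f 6 = s"
      by (simp_all add: f_def numeral_eq_Suc)
    then have "?P (f 1) (f 2) (f 3) (f 4) (f 5) (f 6)" using P by (simp only:)
    then show "\<exists>f :: nat \<Rightarrow> nat. ?P (f 1) (f 2) (f 3) (f 4) (f 5) (f 6)" by (rule exI[of _ f])
  next
    assume "\<exists>f :: nat \<Rightarrow> nat. ?P (f 1) (f 2) (f 3) (f 4) (f 5) (f 6)"
    then show "\<exists>a b p q r s. ?P a b p q r s" by (elim exE) (rule exI)+
  qed
  then show ?thesis
    unfolding rainbow_copy_iff[OF three_graph_paths(2)] unfolding messy_path_def fst_conv snd_conv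
      inj_V inj_E img messy_free_def
    by (simp only: not_all not_imp not_not conj_ac)
qed

lemma rainbow_loose_iff:
  "(\<exists>C. is_copy_in C loose_path (complete_three_graph n) \<and> rainbow c C) \<longleftrightarrow> \<not> loose_free c {..<n}"
proof -
  have V: "{1..7} = set [1, 2, 3, 4, 5, 6, 7 :: nat]" by auto
  have E: "{{1,2,3}, {3,4,5}, {5,6,7}} = set [{1,2,3}, {3,4,5}, {5,6,7} :: nat set]" by simp
  \<comment> \<open>Here the vertex sums are 6, 12 and 18.\<close>
  have dE: "distinct [{1,2,3}, {3,4,5}, {5,6,7} :: nat set]"
    by (rule conjunct1[OF iffD1[OF distinct_map[where f = "sum id"]]]) simp
  let ?P = "\<lambda>a b p q r s t. {a, b, p, q, r, s, t} \<subseteq> {..<n} \<and> distinct [a, b, p, q, r, s, t] \<and>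
    distinct [c {a, b, p}, c {p, q, r}, c {r, s, t}]"
  have inj_V: "inj_on f {1..7} \<longleftrightarrow> distinct [f 1, f 2, f 3, f 4, f 5, f 6, f 7]" for f :: "nat \<Rightarrow> nat"
    unfolding V by (subst inj_on_set_iff) simp_all
  have inj_E: "inj_on (\<lambda>e. c (f ` e)) {{1,2,3}, {3,4,5}, {5,6,7}} \<longleftrightarrow>
      distinct [c {f 1, f 2, f 3}, c {f 3, f 4, f 5}, c {f 5, f 6, f 7}]" for f :: "nat \<Rightarrow> nat"
    unfolding E inj_on_set_iff[OF dE] by simp
  have img: "f ` {1..7} = {f 1, f 2, f 3, f 4, f 5, f 6, f 7}" for f :: "nat \<Rightarrow> nat"
    unfolding V by simp
  have "(\<exists>f :: nat \<Rightarrow> nat. ?P (f 1) (f 2) (f 3) (f 4) (f 5) (f 6) (f 7)) \<longleftrightarrow> (\<exists>a b p q r s t. ?P a b p q r s t)"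
  proof
    assume "\<exists>a b p q r s t. ?P a b p q r s t"
    then obtain a b p q r s t where P: "?P a b p q r s t" by (elim exE)
    define f where "f i = [a, b, p, q, r, s, t] ! (i - 1)" for i :: nat
    have "f 1 = a" "f 2 = b" "f 3 = p" "f 4 = q" "f 5 = r" "f 6 = s" "f 7 = t"
      by (simp_all add: f_def numeral_eq_Suc)
    then have "?P (f 1) (f 2) (f 3) (f 4) (f 5) (f 6) (f 7)" using P by (simp only:)
    then show "\<exists>f :: nat \<Rightarrow> nat. ?P (f 1) (f 2) (f 3) (f 4) (f 5) (f 6) (f 7)" by (rule exI[of _ f])
  next
    assume "\<exists>f :: nat \<Rightarrow> nat. ?P (f 1) (f 2) (f 3) (f 4) (f 5) (f 6) (f 7)"
    then show "\<exists>a b p q r s t. ?P a b p q r s t" by (elim exE) (rule exI)+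
  qed
  then show ?thesis
    unfolding rainbow_copy_iff[OF three_graph_paths(3)] unfolding loose_path_def fst_conv snd_conv
      inj_V inj_E img loose_free_def
    by (simp only: not_all not_imp not_not conj_ac)
qed

subsection \<open>The tight path\<close>

lemma tight_freeD:
  assumes "tight_free c V" "{a, b, p, q, r} \<subseteq> V" "distinct [a, b, p, q, r]"
  shows "c {a, b, p} = c {b, p, q} \<or> c {p, q, r} \<in> {c {a, b, p}, c {b, p, q}}"
  using assms unfolding tight_free_def by fastforce

text \<open>The two given edges prolong to a tight path by each of the triples \<open>abe\<close>,
  \<open>ape\<close>, \<open>bde\<close> and \<open>pde\<close>, which settles these. The triples
  \<open>abd\<close>, \<open>apd\<close>, \<open>bpe\<close> and \<open>ade\<close> are excluded
  from having a third colour by combining several paths.\<close>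

lemma tight_five_shared_pair:
  assumes free: "tight_free c V" and V: "{a, b, p, d, e} \<subseteq> V" and dist: "distinct [a, b, p, d, e]"
    and ne: "c {a, b, p} \<noteq> c {b, p, d}"
    and g: "g \<in> triples {a, b, p, d, e}"
  shows "c g \<in> {c {a, b, p}, c {b, p, d}}"
proof -
  let ?C = "{c {a, b, p}, c {b, p, d}}"
  note G = tight_freeD[OF free]
  have four: "c {a, x, d} \<in> ?C" if xy: "{x, y} = {b, p}" for x y
  proof (rule ccontr)
    assume n: "c {a, x, d} \<notin> ?C"
    have xy': "x = b \<and> y = p \<or> x = p \<and> y = b" using xy by (auto simp: doubleton_eq_iff)
    then have D: "distinct [a, x, y, d, e]" "{a, x, y, d, e} \<subseteq> V"
      and C: "c {a, b, p} = c {a, x, y}" "c {b, p, d} = c {x, y, d}"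
      using V dist by (auto simp: insert_commute)
    \<comment> \<open>If \<open>{a, x, d}\<close> has a third colour, facts 1 and 3 give
      \<open>c {a, x, e} = c {x, y, d}\<close>, and facts 2 and 4 give
      \<open>c {a, y, e} = c {a, x, y}\<close>. Then y, e, a, x, d is a rainbow tight path.\<close>
    have 1: "c {a, x, e} \<in> {c {a, x, y}, c {x, y, d}}"
      using G[of d y x a e] D ne C by (simp add: insert_commute) blast
    have 2: "c {a, y, e} \<in> {c {a, x, y}, c {x, y, d}}"
      using G[of d x y a e] D ne C by (simp add: insert_commute) blast
    have 3: "c {a, x, e} \<in> {c {x, y, d}, c {a, x, d}}"
      using G[of y d x a e] D n C by (simp add: insert_commute) metis
    have 4: "c {a, y, e} \<in> {c {a, x, y}, c {a, x, d}}"
      using G[of d x a y e] D n C by (simp add: insert_commute) metis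
    have "c {a, x, d} \<in> {c {a, y, e}, c {a, x, e}} \<or> c {a, y, e} = c {a, x, e}"
      using G[of y e a x d] D by (simp add: insert_commute) blast
    with 1 2 3 4 n[unfolded C] ne[unfolded C] show False
      unfolding insert_iff empty_iff by metis
  qed
  have abd: "c {a, b, d} \<in> ?C" and apd: "c {a, p, d} \<in> ?C"
    using four[of b p] four[of p b] by (auto simp: insert_commute)
  have abe: "c {a, b, e} \<in> ?C"
    using G[of d p b a e] V dist ne by (simp add: insert_commute) blast
  have ape: "c {a, p, e} \<in> ?C"
    using G[of d b p a e] V dist ne by (simp add: insert_commute) blast
  have bde: "c {b, d, e} \<in> ?C"
    using G[of a p b d e] V dist ne by (simp add: insert_commute) blast
  have pde: "c {p, d, e} \<in> ?C"
    using G[of a b p d e] V dist ne by (simp add: insert_commute)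
  have bpe: "c {b, p, e} \<in> ?C"
  proof (rule ccontr)
    assume n: "c {b, p, e} \<notin> ?C"
    \<comment> \<open>\<open>{a, b, d}\<close> has one of the two known colours, but the paths e, p,
      b, a, d and e, p, b, d, a would give it both.\<close>
    have "c {a, b, d} \<in> {c {a, b, p}, c {b, p, e}}"
      using G[of e p b a d] V dist n by (simp add: insert_commute) blast
    moreover have "c {a, b, d} \<in> {c {b, p, d}, c {b, p, e}}"
      using G[of e p b d a] V dist n by (simp add: insert_commute) blast
    ultimately show False using abd n ne unfolding insert_iff empty_iff by metis
  qed
  have ade: "c {a, d, e} \<in> ?C"
  proof (rule ccontr)
    assume n: "c {a, d, e} \<notin> ?C"
    \<comment> \<open>The paths e, d, a, b, p and e, a, d, b, p both have \<open>{a, b, d}\<close>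
      in the middle, whose colour would have to be that of \<open>{a, b, p}\<close> and also that of
      \<open>{b, p, d}\<close>.\<close>
    have "c {a, b, p} \<in> {c {a, d, e}, c {a, b, d}} \<or> c {a, d, e} = c {a, b, d}"
      using G[of e d a b p] V dist by (simp add: insert_commute) blast
    moreover have "c {b, p, d} \<in> {c {a, d, e}, c {a, b, d}} \<or> c {a, d, e} = c {a, b, d}"
      using G[of e a d b p] V dist by (simp add: insert_commute) blast
    ultimately show False using abd n ne unfolding insert_iff empty_iff by metis
  qed
  obtain x y z where xyz: "g = {x, y, z}" "distinct [x, y, z]"
    using tripleE[OF g] .
  have "x \<in> {a, b, p, d, e}" "y \<in> {a, b, p, d, e}" "z \<in> {a, b, p, d, e}"
    using xyz triplesD(1)[OF g] by auto
  \<comment> \<open>With \<open>C\<close> opaque, each case of the split over the triples closes by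
    matching one of the listed memberships.\<close>
  moreover define C where "C = ?C"
  have "c {a, b, p} \<in> C" "c {b, p, d} \<in> C" "c {a, b, d} \<in> C" "c {a, p, d} \<in> C"
    "c {a, b, e} \<in> C" "c {a, p, e} \<in> C" "c {b, d, e} \<in> C" "c {p, d, e} \<in> C"
    "c {b, p, e} \<in> C" "c {a, d, e} \<in> C"
    using abd apd abe ape bde pde bpe ade unfolding C_def by blast+
  ultimately have "c g \<in> C"
    using xyz by (elim insertE emptyE; simp add: insert_commute)
  then show ?thesis unfolding C_def .
qed

text \<open>Bounding the size of the union saves exhibiting a 5-set at each use. If the colours were
  distinct, no two of the edges could share a pair. Two triples among five vertices meet, so
  \<open>e\<close> and \<open>f\<close> would have exactly one common vertex; the middle edge of a
  tight path from \<open>e\<close> to \<open>f\<close> then repeats one of their colours and shares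
  a pair with the other edge.\<close>

lemma tight_five:
  assumes free: "tight_free c V" and finV: "finite V" "card V \<ge> 5"
    and e: "e \<in> triples V" and f: "f \<in> triples V" and g: "g \<in> triples V"
    and card: "card (e \<union> f \<union> g) \<le> 5"
  shows "c e = c f \<or> c e = c g \<or> c f = c g"
proof (rule ccontr)
  assume n: "\<not> ?thesis"
  obtain Y where Y: "e \<union> f \<union> g \<subseteq> Y" "Y \<subseteq> V" "card Y = 5"
    using exists_subset_between[of "e \<union> f \<union> g" 5 V] finV card triplesD[OF e] triplesD[OF f] triplesD[OF g]
    by auto
  have finY: "finite Y" using Y(3) by (simp add: card_ge_0_finite)
  have pair: False
    if uv: "u \<in> triples Y" "v \<in> triples Y" "w \<in> triples Y" "distinct [c u, c v, c w]" "card (u \<inter> v) = 2"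
    for u v w
  proof -
    obtain b p where bp: "u \<inter> v = {b, p}" "b \<noteq> p" using uv(5) by (auto simp: card_2_iff)
    have "card (u - v) = 1" "card (v - u) = 1"
      using uv triplesD[OF uv(1)] triplesD[OF uv(2)] by (simp_all add: card_Diff_subset_Int Int_commute)
    then obtain a d where ad: "u - v = {a}" "v - u = {d}" by (auto simp: card_1_singleton_iff)
    have u: "u = {a, b, p}" and v: "v = {b, p, d}" and D: "distinct [a, b, p, d]"
      using bp ad by auto
    have "card (Y - {a, b, p, d}) = 1"
      using Y(3) D u v triplesD(1)[OF uv(1)] triplesD(1)[OF uv(2)] by (subst card_Diff_subset) auto
    then obtain q where "Y - {a, b, p, d} = {q}" by (auto simp: card_1_singleton_iff)
    then have "Y = {a, b, p, d, q}" "distinct [a, b, p, d, q]"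
      using u v D triplesD(1)[OF uv(1)] triplesD(1)[OF uv(2)] by auto
    with tight_five_shared_pair[OF free, of a b p d q w] uv u v Y(2) show False
      by auto
  qed
  have Yt: "e \<in> triples Y" "f \<in> triples Y" "g \<in> triples Y"
    using Y(1) e f g by (auto simp: triples_def)
  have "card (e \<union> f) \<le> 5"
    using Y finY by (metis Un_subset_iff card_mono)
  then have "card (e \<inter> f) \<ge> 1"
    using card_Un_Int[of e f] triplesD[OF e] triplesD[OF f] by simp
  moreover have "card (e \<inter> f) \<noteq> 2" using pair[of e f g] Yt n by auto
  moreover have "card (e \<inter> f) \<noteq> 3"
  proof
    assume "card (e \<inter> f) = 3"
    then have "e \<inter> f = e" "e \<inter> f = f"
      using triplesD[OF e] triplesD[OF f] by (metis card_subset_eq inf_le1, metis card_subset_eq inf_le2)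
    then show False using n by auto
  qed
  moreover have "card (e \<inter> f) \<le> 3"
    using triplesD[OF e] by (metis card_mono inf_le1)
  ultimately have "card (e \<inter> f) = 1" by linarith
  then obtain p where p: "e \<inter> f = {p}" by (auto simp: card_1_singleton_iff)
  obtain a b where a: "e = {p, a, b}" "distinct [p, a, b]" using triple_memE[OF e, of p] p by auto
  obtain d q where d: "f = {p, d, q}" "distinct [p, d, q]" using triple_memE[OF f, of p] p by auto
  have D: "distinct [a, b, p, d, q]" using p a d by auto
  have h: "{b, p, d} \<in> triples Y" using D Yt a d by (auto simp: triples_def)
  \<comment> \<open>the middle edge shares a pair with whichever of the two has the other colour\<close>
  have "e \<inter> {b, p, d} = {b, p}" "f \<inter> {b, p, d} = {p, d}" using a d D by auto
  then have c2: "card (e \<inter> {b, p, d}) = 2" "card (f \<inter> {b, p, d}) = 2" using D by auto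
  have "{a, b, p, d, q} \<subseteq> V" using a d Y by auto
  then have "c {b, p, d} \<in> {c e, c f}"
    using tight_freeD[OF free _ D] n a d by (auto simp: insert_commute)
  then show False
    using pair[OF Yt(1) h Yt(3)] pair[OF Yt(2) h Yt(3)] c2 n by auto
qed

section \<open>Adding a vertex and the separating colour\<close>

lemma tight_free_mono: "tight_free c V \<Longrightarrow> X \<subseteq> V \<Longrightarrow> tight_free c X"
  unfolding tight_free_def by (meson order_trans)

text \<open>If \<open>g\<close>, \<open>g'\<close> and the pair \<open>x\<close>, \<open>y\<close>
  span at most four vertices, then with \<open>v\<close> they lie in a 5-set containing an edge of a
  new colour, so the old colours of \<open>g\<close> and \<open>g'\<close> agree. A triple meeting
  the pair is linked in this way to some \<open>{x, y, q}\<close> and then to a fixed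
  \<open>{x, y, p}\<close>.\<close>

lemma tight_new_colour:
  assumes free: "tight_free c (insert v X)" and X: "finite X" "card X \<ge> 5" "v \<notin> X"
    and xy: "x \<in> X" "y \<in> X" "x \<noteq> y" and new: "c {v, x, y} \<notin> c ` triples X"
  obtains d where "\<And>g. g \<in> triples X \<Longrightarrow> g \<inter> {x, y} \<noteq> {} \<Longrightarrow> c g = d"
proof -
  let ?h = "{v, x, y}"
  have h: "?h \<in> triples (insert v X)" using X xy by (intro triplesI) auto
  have sub: "triples X \<subseteq> triples (insert v X)" by (rule triples_mono) auto
  have same: "c g = c g'" if "g \<in> triples X" "g' \<in> triples X" "card (g \<union> g' \<union> {x, y}) \<le> 4" for g g'
  proof -
    have "g \<union> g' \<union> ?h = insert v (g \<union> g' \<union> {x, y})" by auto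
    also have "card \<dots> \<le> 5"
      using that(3) card_insert_le_m1[of 5 "g \<union> g' \<union> {x, y}" v] by simp
    finally have "c g = c g' \<or> c g = c ?h \<or> c g' = c ?h"
      using tight_five[OF free _ _ subsetD[OF sub that(1)] subsetD[OF sub that(2)] h] X by simp
    then show ?thesis using new that(1,2) by (metis image_eqI)
  qed
  have card4: "card {x, y, p, q} \<le> 4" for p q
    by (rule order_trans[OF card_length[of "[x, y, p, q]", simplified list.set]]) simp
  obtain p where p: "p \<in> X" "p \<notin> {x, y}"
  proof -
    have "\<not> X \<subseteq> {x, y}" using X card_mono[of "{x, y}" X] xy by auto
    then show thesis using that by blast
  qed
  have "c g = c {x, y, p}" if g: "g \<in> triples X" "g \<inter> {x, y} \<noteq> {}" for g
  proof -
    have "\<not> g \<subseteq> {x, y}" using triplesD[OF g(1)] card_mono[of "{x, y}" g] xy by auto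
    then obtain q where q: "q \<in> g" "q \<notin> {x, y}" by blast
    have qX: "q \<in> X" using q g triplesD by blast
    have t: "{x, y, p} \<in> triples X" "{x, y, q} \<in> triples X"
      using xy p q qX by (auto simp: triples_def)
    have "card (g \<union> {x, y}) \<le> 4"
    proof -
      have "1 \<le> card (g \<inter> {x, y})"
        using g(2) by (metis One_nat_def Suc_leI card_gt_0_iff finite.emptyI finite.insertI finite_Int)
      then show ?thesis using card_Un_Int[of g "{x, y}"] triplesD[OF g(1)] xy by simp
    qed
    moreover have "g \<union> {x, y, q} \<union> {x, y} = g \<union> {x, y}" using q by auto
    ultimately have "c g = c {x, y, q}" using same[OF g(1) t(2)] by simp
    moreover have "{x, y, q} \<union> {x, y, p} \<union> {x, y} = {x, y, q, p}" by auto
    then have "c {x, y, q} = c {x, y, p}" using same[OF t(2) t(1)] card4 by simp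
    ultimately show ?thesis by simp
  qed
  then show thesis by (rule that)
qed

text \<open>\<open>z\<close> acts as a background colour. Edges of one and the same other colour may
  overlap; what the final count uses is that representatives of different other colours are
  disjoint.\<close>

definition separating_colour :: "('a set \<Rightarrow> 'c) \<Rightarrow> 'a set \<Rightarrow> 'c \<Rightarrow> bool" where
  "separating_colour c V z \<longleftrightarrow> (\<forall>e\<in>triples V. \<forall>f\<in>triples V.
     c e \<noteq> z \<longrightarrow> c f \<noteq> z \<longrightarrow> c e \<noteq> c f \<longrightarrow> e \<inter> f = {})"

text \<open>If no new colour appears, one of the two old colours separates trivially. Otherwise the
  colour \<open>d\<close> common to all triples of \<open>X\<close> that meet the pair of a newly
  coloured edge \<open>h\<close> works: edges at \<open>v\<close> have the colour of
  \<open>h\<close> or \<open>d\<close>, and at most one old colour differs from \<open>d\<close>, so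
  the only real case compares an edge at \<open>v\<close> with an edge in \<open>X\<close>.\<close>

lemma separating_colour_step_two:
  assumes free: "tight_free c (insert v X)" and X: "finite X" "card X \<ge> 5" "v \<notin> X"
    and two: "c ` triples X \<subseteq> {k1, k2}"
  shows "\<exists>z. separating_colour c (insert v X) z"
proof (cases "c ` triples (insert v X) \<subseteq> {k1, k2}")
  case True
  then have "c e = k2" if "e \<in> triples (insert v X)" "c e \<noteq> k1" for e using that by blast
  then have "separating_colour c (insert v X) k1"
    unfolding separating_colour_def by metis
  then show ?thesis ..
next
  case False
  have inX: "e \<in> triples X" if "e \<in> triples (insert v X)" "v \<notin> e" for e
    using that by (auto simp: triples_def)
  have sub: "triples X \<subseteq> triples (insert v X)" by (rule triples_mono) auto
  obtain h where h: "h \<in> triples (insert v X)" "c h \<notin> {k1, k2}" using False by blast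
  then have "v \<in> h" using inX two by blast
  then obtain x y where hxy: "h = {v, x, y}" "distinct [v, x, y]" using triple_memE[OF h(1)] by blast
  then have xy: "x \<in> X" "y \<in> X" "x \<noteq> y" using triplesD(1)[OF h(1)] by auto
  have "c {v, x, y} \<notin> c ` triples X" using h hxy two by blast
  then obtain d where d: "\<And>g. g \<in> triples X \<Longrightarrow> g \<inter> {x, y} \<noteq> {} \<Longrightarrow> c g = d"
    using tight_new_colour[OF free X xy] by blast
  have dk: "d \<in> {k1, k2}"
  proof -
    obtain g where g: "g \<in> triples X" "{x, y} \<subseteq> g"
      using triple_supersetE[of "{x, y}" X] X xy by auto
    then have "c g = d" using d by blast
    then show ?thesis using g two by blast
  qed
  have at_v: "c e \<in> {c h, d}" if e: "e \<in> triples (insert v X)" "v \<in> e" for e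
  proof (cases "e = h")
    case False
    obtain a b where ab: "e = {v, a, b}" "distinct [v, a, b]" using triple_memE[OF e] by blast
    have "\<not> {a, b} \<subseteq> {x, y}" using False ab hxy by auto
    \<comment> \<open>The vertex \<open>s\<close> provides an edge \<open>{x, y, s}\<close> of
      colour \<open>d\<close> in one 5-set with \<open>e\<close> and \<open>h\<close>.\<close>
    then obtain s where s: "s \<in> {a, b}" "s \<notin> {x, y}" by blast
    have g: "{x, y, s} \<in> triples X"
      using s xy ab triplesD(1)[OF e(1)] by (auto simp: triples_def)
    have "e \<union> h \<union> {x, y, s} = set [v, x, y, a, b]" using ab hxy s by auto
    then have "card (e \<union> h \<union> {x, y, s}) \<le> 5"
      using card_length[of "[v, x, y, a, b]"] by simp
    then have "c e = c h \<or> c e = c {x, y, s} \<or> c h = c {x, y, s}"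
      using tight_five[OF free _ _ e(1) h(1) subsetD[OF sub g]] X by simp
    moreover have "c {x, y, s} = d" using d[OF g] by simp
    ultimately show ?thesis using h dk by auto
  qed simp
  have mixed: "e \<inter> f = {}"
    if e: "e \<in> triples (insert v X)" "v \<in> e" "c e \<noteq> d" and f: "f \<in> triples X" "c f \<noteq> d" for e f
  proof (rule ccontr)
    assume meet: "e \<inter> f \<noteq> {}"
    obtain a b where ab: "e = {v, a, b}" "distinct [v, a, b]" using triple_memE[OF e(1,2)] by blast
    have abX: "a \<in> X" "b \<in> X" "a \<noteq> b" using ab triplesD(1)[OF e(1)] by auto
    have "c {v, a, b} = c h" using at_v[OF e(1,2)] e(3) ab(1) by simp
    then have "c {v, a, b} \<notin> c ` triples X" using h(2) two by auto
    then obtain d' where d': "\<And>g. g \<in> triples X \<Longrightarrow> g \<inter> {a, b} \<noteq> {} \<Longrightarrow> c g = d'"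
      using tight_new_colour[OF free X abX] by blast
    have "v \<notin> f" using f X triplesD by blast
    then have "c f = d'" using d' f meet ab by blast
    \<comment> \<open>A triple through \<open>x\<close> and \<open>a\<close> meets both pairs, so it
      has colour \<open>d\<close> and colour \<open>d'\<close>. The two vertices may
      coincide.\<close>
    moreover obtain g where "g \<in> triples X" "{x, a} \<subseteq> g"
    proof (rule triple_supersetE[of "{x, a}" X])
      show "card {x, a} \<le> 3" by (simp add: card_insert_if)
    qed (use X xy abX in auto)
    then have "d = d'" using d[of g] d'[of g] by blast
    ultimately show False using f by simp
  qed
  have "e \<inter> f = {}"
    if e: "e \<in> triples (insert v X)" "c e \<noteq> d" and f: "f \<in> triples (insert v X)" "c f \<noteq> d"
      and ne: "c e \<noteq> c f" for e f
  proof -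
    consider "v \<in> e" "v \<in> f" | "v \<in> e" "v \<notin> f" | "v \<notin> e" "v \<in> f" | "v \<notin> e" "v \<notin> f" by blast
    then show ?thesis
    proof cases
      case 1
      then show ?thesis using at_v[of e] at_v[of f] e f ne by auto
    next
      case 2
      then show ?thesis using mixed e f inX by blast
    next
      case 3
      then show ?thesis using mixed[of f e] e f inX by blast
    next
      case 4
      then have "c e \<in> {k1, k2}" "c f \<in> {k1, k2}" using inX e f two by blast+
      then show ?thesis using e f ne dk by auto
    qed
  qed
  then have "separating_colour c (insert v X) d" unfolding separating_colour_def by blast
  then show ?thesis ..
qed

text \<open>Suppose \<open>e\<close> and \<open>f\<close> violate the claim. In a 5-set around them,
  one of the two, \<open>h = {v, a, b}\<close>, has a colour confined to edges at \<open>v\<close>,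
  so every triple there avoiding \<open>v\<close> has the other colour \<open>k\<close>. That colour
  spreads to all triples of \<open>X\<close> meeting \<open>{a, b}\<close>, and separation on
  \<open>X\<close> then leaves only \<open>z\<close> and \<open>k\<close>, contradicting the
  presence of a third colour.\<close>

lemma separating_colour_step_three:
  assumes free: "tight_free c (insert v X)" and X: "finite X" "card X \<ge> 5" "v \<notin> X"
    and sep: "separating_colour c X z" and three: "\<And>k1 k2. \<not> c ` triples X \<subseteq> {k1, k2}"
  shows "separating_colour c (insert v X) z"
  unfolding separating_colour_def
proof (intro ballI impI, rule ccontr)
  fix e f
  assume e: "e \<in> triples (insert v X)" "c e \<noteq> z" and f: "f \<in> triples (insert v X)" "c f \<noteq> z"
    and ne: "c e \<noteq> c f" and meet: "e \<inter> f \<noteq> {}"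
  have sepD: "c s = c t" if "s \<in> triples X" "t \<in> triples X" "c s \<noteq> z" "c t \<noteq> z" "s \<inter> t \<noteq> {}" for s t
    using sep that unfolding separating_colour_def by blast
  have inX: "e \<in> triples X" if "e \<in> triples (insert v X)" "v \<notin> e" for e
    using that by (auto simp: triples_def)
  have sub: "triples X \<subseteq> triples (insert v X)" by (rule triples_mono) auto
  have five: "c r = c s \<or> c r = c t \<or> c s = c t"
    if "r \<in> triples (insert v X)" "s \<in> triples (insert v X)" "t \<in> triples (insert v X)"
      "card (r \<union> s \<union> t) \<le> 5" for r s t
    using tight_five[OF free _ _ that] X by simp
  have "1 \<le> card (e \<inter> f)"
    using meet triplesD(3)[OF e(1)] by (metis One_nat_def Suc_leI card_gt_0_iff finite_Int)
  then have "card (e \<union> f) \<le> 5" using card_Un_Int[of e f] triplesD[OF e(1)] triplesD[OF f(1)] by simp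
  then obtain Y where Y: "e \<union> f \<subseteq> Y" "Y \<subseteq> insert v X" "card Y = 5"
    using exists_subset_between[of "e \<union> f" 5 "insert v X"] X triplesD(1)[OF e(1)] triplesD(1)[OF f(1)]
    by auto
  have finY: "finite Y" using Y(3) by (simp add: card_ge_0_finite)
  have Ycol: "c g \<in> {c e, c f}" if "g \<in> triples Y" for g
  proof -
    have "card (e \<union> f \<union> g) \<le> 5"
      using card_mono[OF finY, of "e \<union> f \<union> g"] Y triplesD(1)[OF that] by simp
    then show ?thesis
      using five[OF e(1) f(1) subsetD[OF triples_mono[OF Y(2)] that]] ne by auto
  qed
  \<comment> \<open>Otherwise both colours occur in \<open>Y\<close> away from \<open>v\<close>, on
    two triples among four vertices. These meet, which separation on \<open>X\<close>
    forbids.\<close>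
  have "\<exists>h\<in>{e, f}. v \<in> h \<and> (\<forall>g\<in>triples Y. v \<notin> g \<longrightarrow> c g \<noteq> c h)"
  proof (rule ccontr)
    assume contr: "\<not> ?thesis"
    have *: "\<exists>g \<in> triples Y. v \<notin> g \<and> c g = c h" if "h \<in> {e, f}" for h
    proof (cases "v \<in> h")
      case True
      then show ?thesis using contr that by blast
    next
      case False
      then show ?thesis using that Y(1) e f by (intro bexI[of _ h]) (auto simp: triples_def)
    qed
    obtain s t where st: "s \<in> triples Y" "v \<notin> s" "c s = c e" "t \<in> triples Y" "v \<notin> t" "c t = c f"
      using *[of e] *[of f] by auto
    have "v \<in> Y" 
    proof (rule ccontr)
      assume "v \<notin> Y"
      then have "e \<in> triples X" "f \<in> triples X" using Y e f inX by blast+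
      then show False using sepD e f ne meet by blast
    qed
    then have "card (Y - {v}) = 4" using Y(3) by simp
    moreover have "s \<union> t \<subseteq> Y - {v}" using st triplesD by blast
    ultimately have "card (s \<union> t) \<le> 4" using finY by (metis card_mono finite_Diff)
    then have "s \<inter> t \<noteq> {}" using card_Un_disjoint[of s t] st triplesD by fastforce
    moreover have "s \<in> triples X" "t \<in> triples X" using st Y(2) by (auto simp: triples_def)
    ultimately show False using sepD[of s t] st e f ne by simp
  qed
  then obtain h where h: "h \<in> {e, f}" "v \<in> h" "\<And>g. g \<in> triples Y \<Longrightarrow> v \<notin> g \<Longrightarrow> c g \<noteq> c h"
    by blast
  obtain k where k: "k \<in> {c e, c f}" "k \<noteq> c h" using ne by (metis insertI1 insertI2)
  have Yk: "c g = k" if "g \<in> triples Y" "v \<notin> g" for g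
    using Ycol[OF that(1)] h(3)[OF that] k h(1) by (metis empty_iff insert_iff)
  have kz: "k \<noteq> z" "c h \<noteq> z" using k(1) h(1) e(2) f(2) by auto
  have hV: "h \<in> triples (insert v X)" using h(1) e(1) f(1) by auto
  obtain a b where ab: "h = {v, a, b}" "distinct [v, a, b]" using triple_memE[OF hV h(2)] by blast
  have abX: "a \<in> X" "b \<in> X" "a \<in> Y" "b \<in> Y" using ab triplesD(1)[OF hV] h(1) Y by auto
  have "\<not> Y \<subseteq> {v, a, b}" using card_mono[of "{v, a, b}" Y] Y(3) ab by auto
  then obtain p where p: "p \<in> Y" "p \<notin> {v, a, b}" by blast
  have abp: "{a, b, p} \<in> triples X" "c {a, b, p} = k"
  proof -
    show "{a, b, p} \<in> triples X" using abX p Y ab by (auto simp: triples_def)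
    have "{a, b, p} \<in> triples Y" "v \<notin> {a, b, p}" using abX p ab by (auto simp: triples_def)
    then show "c {a, b, p} = k" by (rule Yk)
  qed
  \<comment> \<open>The 5-set allows \<open>g\<close> only the colours \<open>k\<close> and
    \<open>c h\<close>. Both differ from \<open>z\<close>, so separation on \<open>X\<close> makes
    the intersecting triples \<open>g\<close> and \<open>g'\<close> agree.\<close>
  have ext: "c g = k"
    if "g \<in> triples X" "g' \<in> triples X" "c g' = k" "g \<inter> g' \<noteq> {}" "card (g' \<union> g \<union> {v, a, b}) \<le> 5" for g g'
  proof -
    have "c g' = c g \<or> c g' = c h \<or> c g = c h"
      using five[of g' g h] that sub hV ab by blast
    then have "c g \<in> {k, c h}" using that k by auto
    then show ?thesis using sepD[of g g'] that kz by auto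
  qed
  have abu: "c {a, b, u} = k" if "{a, b, u} \<in> triples X" for u
  proof (rule ext[OF that abp])
    have "{a, b, p} \<union> {a, b, u} \<union> {v, a, b} = set [a, b, p, u, v]" by auto
    then show "card ({a, b, p} \<union> {a, b, u} \<union> {v, a, b}) \<le> 5"
      using card_length[of "[a, b, p, u, v]"] by simp
  qed auto
  have meets: "c g = k" if g: "g \<in> triples X" "g \<inter> {a, b} \<noteq> {}" for g
  proof -
    have "\<not> g \<subseteq> {a, b}" using triplesD[OF g(1)] card_mono[of "{a, b}" g] ab by auto
    then obtain q where q: "q \<in> g" "q \<notin> {a, b}" by blast
    have t: "{a, b, q} \<in> triples X"
      using abX ab q triplesD(1)[OF g(1)] by (auto simp: triples_def)
    show ?thesis
    proof (rule ext[OF g(1) t abu[OF t]])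
      show "g \<inter> {a, b, q} \<noteq> {}" using q by blast
      have "1 \<le> card (g \<inter> {a, b})"
        using g(2) by (metis One_nat_def Suc_leI card_gt_0_iff finite.emptyI finite.insertI finite_Int)
      then have "card (g \<union> {a, b}) \<le> 4" using card_Un_Int[of g "{a, b}"] triplesD[OF g(1)] ab by simp
      moreover have "{a, b, q} \<union> g \<union> {v, a, b} = insert v (g \<union> {a, b})" using q by auto
      ultimately show "card ({a, b, q} \<union> g \<union> {v, a, b}) \<le> 5"
        using card_insert_le_m1[of 5 "g \<union> {a, b}" v] by simp
    qed
  qed
  have "c ` triples X \<subseteq> {z, k}"
  proof (rule image_subsetI, rule ccontr)
    fix g assume g: "g \<in> triples X" "c g \<notin> {z, k}"
    then have "g \<inter> {a, b} = {}" using meets by blast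
    obtain s t u where stu: "g = {s, t, u}" "distinct [s, t, u]" using tripleE[OF g(1)] .
    \<comment> \<open>This triple meets \<open>{a, b}\<close>, so it has colour \<open>k\<close>; it
      also meets \<open>g\<close>, which separation on \<open>X\<close> excludes.\<close>
    then have ast: "{a, s, t} \<in> triples X"
      using \<open>g \<inter> {a, b} = {}\<close> abX triplesD(1)[OF g(1)] by (auto simp: triples_def)
    then have "c {a, s, t} = k" using meets by blast
    then show False using sepD[OF g(1) ast] g stu kz by auto
  qed
  then show False using three by blast
qed

text \<open>The induction really starts at five vertices, where there are at most two colours and
  the colour of any edge will do. Beyond that, with at most two colours on \<open>X\<close> the
  separating colour may have to change; with three or more the old one survives.\<close>

lemma tight_separating_colour:
  assumes "finite V" "card V \<ge> 5" "tight_free c V"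
  shows "\<exists>z. separating_colour c V z"
  using assms
proof (induction V rule: finite_induct)
  case (insert v X)
  show ?case
  proof (cases "card X \<ge> 5")
    case True
    then obtain z where z: "separating_colour c X z"
      using insert tight_free_mono[of c "insert v X" X] by blast
    show ?thesis
    proof (cases "\<exists>k1 k2. c ` triples X \<subseteq> {k1, k2}")
      case True
      then show ?thesis
        using separating_colour_step_two[OF insert.prems(2)] insert \<open>card X \<ge> 5\<close> by blast
    next
      case False
      then show ?thesis
        using separating_colour_step_three[OF insert.prems(2) _ _ _ z] insert \<open>card X \<ge> 5\<close> by blast
    qed
  next
    case False
    let ?V = "insert v X"
    \<comment> \<open>The premise on \<open>insert v X\<close> leaves exactly four vertices for
      \<open>X\<close>.\<close>
    have V: "finite ?V" "card ?V = 5" using False insert by auto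
    obtain g where g: "g \<in> triples ?V"
      using triple_supersetE[of "{}" ?V] V by auto
    have "c e = c g \<or> c f = c g \<or> c e = c f" if "e \<in> triples ?V" "f \<in> triples ?V" for e f
    proof -
      have "card (e \<union> f \<union> g) \<le> 5"
        using card_mono[OF V(1), of "e \<union> f \<union> g"] V(2) that g triplesD(1) by fastforce
      then show ?thesis using tight_five[OF insert.prems(2) V(1) _ that g] V(2) by auto
    qed
    then have "separating_colour c ?V (c g)" unfolding separating_colour_def by metis
    then show ?thesis ..
  qed
qed simp

text \<open>Representatives of the colours other than the separating one are pairwise disjoint
  triples, so there are at most \<open>card V div 3\<close> of them; the separating colour adds
  one.\<close>

lemma tight_free_card_colours:
  assumes V: "finite V" "card V \<ge> 5" and free: "tight_free c V"
  shows "card (c ` triples V) \<le> card V div 3 + 1"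
proof -
  obtain z where z: "separating_colour c V z" using tight_separating_colour[OF V free] ..
  define K where "K = c ` triples V - {z}"
  define r where "r k = (SOME e. e \<in> triples V \<and> c e = k)" for k
  have r: "r k \<in> triples V" "c (r k) = k" if "k \<in> K" for k
    using someI_ex[of "\<lambda>e. e \<in> triples V \<and> c e = k"] that unfolding K_def r_def by auto
  have finK: "finite K" unfolding K_def using finite_triples[OF V(1)] by blast
  have disj: "r k \<inter> r l = {}" if "k \<in> K" "l \<in> K" "k \<noteq> l" for k l
    using z r[OF that(1)] r[OF that(2)] that unfolding separating_colour_def K_def by auto
  have "card (\<Union>k\<in>K. r k) = (\<Sum>k\<in>K. card (r k))"
    using finK r triplesD(3) disj by (intro card_UN_disjoint) blast+
  also have "\<dots> = 3 * card K" 
  proof -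
    have "(\<Sum>k\<in>K. card (r k)) = (\<Sum>k\<in>K. 3)"
      using r(1) triplesD(2) by (intro sum.cong) blast+
    then show ?thesis by simp
  qed
  finally have "3 * card K \<le> card V"
    using card_mono[OF V(1), of "\<Union>k\<in>K. r k"] r triplesD(1) by fastforce
  moreover have "card (c ` triples V) \<le> card K + 1"
    unfolding K_def using diff_card_le_card_Diff[of "{z}" "c ` triples V"] by simp
  ultimately show ?thesis by linarith
qed

subsection \<open>The messy path\<close>

text \<open>Exchanging one vertex of \<open>e\<close> for one of \<open>f\<close> involves four
  vertices. Of seven or more, three remain for a triple disjoint from both the old and the new edge,
  whose colour both share. Each exchange brings \<open>e\<close> closer to \<open>f\<close>.\<close>

lemma disjoint_triples_connected:
  assumes V: "finite V" "card V \<ge> 7"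
    and disj: "\<And>e f. e \<in> triples V \<Longrightarrow> f \<in> triples V \<Longrightarrow> e \<inter> f = {} \<Longrightarrow> c e = c f"
    and e: "e \<in> triples V" and f: "f \<in> triples V"
  shows "c e = c f"
  using e
proof (induction "card (e - f)" arbitrary: e rule: less_induct)
  case less
  show ?case
  proof (cases "e = f")
    case False
    note E = triplesD[OF less.prems] and F = triplesD[OF f]
    have "\<not> e \<subseteq> f" using False E F card_subset_eq[of f e] by auto
    then obtain a where a: "a \<in> e" "a \<notin> f" by blast
    have "\<not> f \<subseteq> e" using False E F card_subset_eq[of e f] by auto
    then obtain b where b: "b \<in> f" "b \<notin> e" by blast
    define e' where "e' = insert b (e - {a})"
    have e': "e' \<in> triples V" using a b E F by (auto simp: triples_def e'_def)
    have "card (insert b e) = 4" using b E by simp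
    then have "card (V - insert b e) \<ge> 3"
      using V b E F card_Diff_subset[of "insert b e" V] by auto
    then obtain g where g: "g \<in> triples (V - insert b e)"
      using triple_supersetE[of "{}" "V - insert b e"] V by auto
    then have gV: "g \<in> triples V" "e \<inter> g = {}" "e' \<inter> g = {}"
      unfolding triples_def e'_def by blast+
    have "e' - f \<subset> e - f" using a b by (auto simp: e'_def)
    then have "card (e' - f) < card (e - f)" using E by (intro psubset_card_mono) auto
    then have "c e' = c f" using less.hyps e' by blast
    moreover have "c e = c e'" using disj[OF less.prems gV(1,2)] disj[OF e' gV(1,3)] by simp
    ultimately show ?thesis by simp
  qed simp
qed

text \<open>A triple of \<open>A \<union> B\<close> other than \<open>A\<close> and \<open>B\<close>
  has two vertices in one of them and one in the other, so it is the middle edge of a messy path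
  with end edges \<open>A\<close> and \<open>B\<close>. The local fact \<open>main\<close> is stated
  for \<open>P\<close> and \<open>Q\<close> to cover both roles.\<close>

lemma messy_six:
  assumes free: "messy_free c V" and A: "A \<in> triples V" and B: "B \<in> triples V"
    and disj: "A \<inter> B = {}" and ne: "c A \<noteq> c B" and g: "g \<in> triples (A \<union> B)"
  shows "c g \<in> {c A, c B}"
proof -
  have main: "c g \<in> {c P, c Q}"
    if P: "P \<in> triples V" and Q: "Q \<in> triples V" and PQ: "P \<inter> Q = {}" and ne: "c P \<noteq> c Q"
      and g: "g \<in> triples (P \<union> Q)" and card: "card (g \<inter> P) = 2" for P Q
  proof -
    obtain b p where bp: "g \<inter> P = {b, p}" "b \<noteq> p" using card by (auto simp: card_2_iff)
    have "card (g - P) = 1" "card (P - g) = 1"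
      using card triplesD[OF g] triplesD[OF P] by (simp_all add: card_Diff_subset_Int Int_commute)
    then obtain d a where da: "g - P = {d}" "P - g = {a}" by (auto simp: card_1_singleton_iff)
    have "d \<in> Q" using da triplesD(1)[OF g] by blast
    then obtain s t where Qst: "Q = {d, s, t}" "distinct [d, s, t]" using triple_memE[OF Q] by blast
    have Pg: "P = {a, b, p}" "g = {b, p, d}" using bp da by auto
    have "a \<in> P" "a \<notin> g" using da by blast+
    then have "a \<notin> {b, p}" using bp by blast
    moreover have "{a, b, p} \<inter> {d, s, t} = {}" using PQ Pg Qst by simp
    ultimately have "distinct [a, b, p, d, s, t]" using bp(2) Qst(2) by auto
    moreover have "{a, b, p, d, s, t} \<subseteq> V"
      using triplesD(1)[OF P] triplesD(1)[OF Q] Pg Qst by auto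
    ultimately have "\<not> distinct [c {a, b, p}, c {b, p, d}, c {d, s, t}]"
      by (intro free[unfolded messy_free_def, rule_format] conjI)
    then have "\<not> distinct [c P, c g, c Q]" unfolding Pg Qst .
    then show ?thesis using ne by auto
  qed
  have "card (g \<inter> A) + card (g \<inter> B) = 3"
  proof -
    have "g = (g \<inter> A) \<union> (g \<inter> B)" using triplesD(1)[OF g] by blast
    then have "card g = card (g \<inter> A) + card (g \<inter> B)"
      using card_Un_disjoint[of "g \<inter> A" "g \<inter> B"] triplesD(3)[OF g] disj by auto
    then show ?thesis using triplesD[OF g] by simp
  qed
  then consider "card (g \<inter> A) = 3" | "card (g \<inter> B) = 3" | "card (g \<inter> A) = 2" | "card (g \<inter> B) = 2"
    by linarith
  then show ?thesis
  proof cases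
    case 1
    then have "g = A" using triplesD[OF g] triplesD[OF A] card_subset_eq inf_le1 inf_le2 by metis
    then show ?thesis by simp
  next
    case 2
    then have "g = B" using triplesD[OF g] triplesD[OF B] card_subset_eq inf_le1 inf_le2 by metis
    then show ?thesis by simp
  next
    case 3
    then show ?thesis using main[OF A B disj ne g] by simp
  next
    case 4
    then show ?thesis using main[OF B A] disj ne g by (auto simp: Int_commute Un_commute)
  qed
qed

text \<open>A triple \<open>D\<close> of \<open>X\<close> avoiding \<open>x\<close> and
  \<open>y\<close> is disjoint from the new edge and coloured differently, so by
  \<open>messy_six\<close> all triples of \<open>D \<union> {x, y}\<close> have the colour of
  \<open>D\<close>. Every triple of \<open>X\<close> lies in such a set together with some
  \<open>{x, y, d}\<close>, and so do any two triples of the latter form.\<close>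

lemma messy_new_colour:
  assumes free: "messy_free c (insert w X)" and X: "finite X" "card X \<ge> 5" "w \<notin> X"
    and xy: "x \<in> X" "y \<in> X" "x \<noteq> y" and new: "c {w, x, y} \<notin> c ` triples X"
    and g: "g \<in> triples X" and g': "g' \<in> triples X"
  shows "c g = c g'"
proof -
  have h: "{w, x, y} \<in> triples (insert w X)" using X xy by (intro triplesI) auto
  have sub: "triples X \<subseteq> triples (insert w X)" by (rule triples_mono) auto
  let ?X = "X - {x, y}"
  have X': "finite ?X" "card ?X \<ge> 3"
    using X xy card_Diff_subset[of "{x, y}" X] by auto
  have D: "c t = c D" if "D \<in> triples ?X" "t \<in> triples (D \<union> {x, y})" for D t
  proof -
    have DX: "D \<in> triples X" "D \<inter> {w, x, y} = {}" using that(1) X(3) by (auto simp: triples_def)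
    have tX: "t \<in> triples X" using that DX xy by (auto simp: triples_def)
    have "t \<in> triples (D \<union> {w, x, y})" using that(2) by (auto simp: triples_def)
    moreover have "c D \<noteq> c {w, x, y}" using new DX by (metis image_eqI)
    ultimately have "c t \<in> {c D, c {w, x, y}}"
      using messy_six[OF free subsetD[OF sub DX(1)] h DX(2)] by blast
    then show ?thesis using new tX by (metis empty_iff image_eqI insert_iff)
  qed
  have to_pair: "\<exists>d\<in>?X. c t = c {x, y, d}" if "t \<in> triples X" for t
  proof -
    have "card (t - {x, y}) \<le> 3" using triplesD[OF that] by (metis card_mono Diff_subset)
    moreover have "t - {x, y} \<subseteq> ?X" using triplesD(1)[OF that] by blast
    ultimately obtain E where E: "E \<in> triples ?X" "t - {x, y} \<subseteq> E"
      using triple_supersetE[of "t - {x, y}" ?X] X' by auto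
    have "E \<noteq> {}" using triplesD[OF E(1)] by auto
    then obtain d where d: "d \<in> E" by blast
    then have dX: "d \<in> ?X" using triplesD(1)[OF E(1)] by blast
    have "{x, y, d} \<in> triples (E \<union> {x, y})" using d dX xy by (intro triplesI) auto
    moreover have "t \<in> triples (E \<union> {x, y})" using that E by (auto simp: triples_def)
    ultimately have "c t = c {x, y, d}" using D[OF E(1)] by metis
    then show ?thesis using dX by blast
  qed
  have pairs: "c {x, y, d} = c {x, y, d'}" if d: "d \<in> ?X" "d' \<in> ?X" for d d'
  proof -
    have "card {d, d'} \<le> 3" by (simp add: card_insert_if)
    then obtain E where E: "E \<in> triples ?X" "{d, d'} \<subseteq> E"
      using triple_supersetE[of "{d, d'}" ?X] X' d by auto
    have "{x, y, d} \<in> triples (E \<union> {x, y})" "{x, y, d'} \<in> triples (E \<union> {x, y})"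
      using E d xy by (auto intro!: triplesI)
    then show ?thesis using D[OF E(1)] by metis
  qed
  show ?thesis using to_pair[OF g] to_pair[OF g'] pairs by metis
qed

lemma messy_free_mono:
  assumes "messy_free c V" "X \<subseteq> V"
  shows "messy_free c X"
  unfolding messy_free_def
proof (intro allI impI, elim conjE)
  fix a b p q r s
  assume a: "{a, b, p, q, r, s} \<subseteq> X" "distinct [a, b, p, q, r, s]"
  show "\<not> distinct [c {a, b, p}, c {b, p, q}, c {q, r, s}]"
    using a(2) subset_trans[OF a(1) assms(2)]
    by (intro assms(1)[unfolded messy_free_def, rule_format] conjI)
qed

text \<open>Start from the six vertices of disjoint edges \<open>A\<close>, \<open>B\<close> of
  different colours. A third colour at an added vertex would make the earlier triples monochromatic,
  which \<open>A\<close> and \<open>B\<close> prevent. Without such a pair the colouring is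
  constant.\<close>

lemma messy_free_two_colours:
  assumes V: "finite V" "card V \<ge> 7" and free: "messy_free c V"
  shows "card (c ` triples V) \<le> 2"
proof (cases "\<exists>A\<in>triples V. \<exists>B\<in>triples V. A \<inter> B = {} \<and> c A \<noteq> c B")
  case True
  then obtain A B where A: "A \<in> triples V" and B: "B \<in> triples V" and AB: "A \<inter> B = {}" "c A \<noteq> c B"
    by blast
  let ?S = "A \<union> B"
  have S: "finite ?S" "card ?S = 6"
    using triplesD[OF A] triplesD[OF B] AB by (auto simp: card_Un_disjoint)
  have "c ` triples (W \<union> ?S) \<subseteq> {c A, c B}" if "finite W" "W \<subseteq> V - ?S" for W
    using that
  proof (induction W rule: finite_induct)
    case empty
    then show ?case using messy_six[OF free A B AB] by auto
  next
    case (insert w W)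
    let ?X = "W \<union> ?S"
    have IH: "c ` triples ?X \<subseteq> {c A, c B}" using insert by blast
    have X: "finite ?X" "card ?X \<ge> 5" "w \<notin> ?X"
      using insert S card_mono[of ?X ?S] by auto
    have "?X \<subseteq> V" "w \<in> V" using insert triplesD(1)[OF A] triplesD(1)[OF B] by auto
    then have free': "messy_free c (insert w ?X)" using messy_free_mono[OF free] by simp
    have ABX: "A \<in> triples ?X" "B \<in> triples ?X" using A B by (auto simp: triples_def)
    have "c t \<in> {c A, c B}" if t: "t \<in> triples (insert w ?X)" for t
    proof (cases "w \<in> t")
      case True
      obtain x y where xy: "t = {w, x, y}" "distinct [w, x, y]" using triple_memE[OF t True] by blast
      have xyX: "x \<in> ?X" "y \<in> ?X" "x \<noteq> y" using xy triplesD(1)[OF t] by auto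
      have "c {w, x, y} \<in> c ` triples ?X"
        using messy_new_colour[OF free' X xyX _ ABX] AB(2) by blast
      then show ?thesis using IH xy by blast
    next
      case False
      then have "t \<in> triples ?X" using t by (auto simp: triples_def)
      then show ?thesis using IH by blast
    qed
    then show ?case by auto
  qed
  from this[of "V - ?S"] have "c ` triples (V - ?S \<union> ?S) \<subseteq> {c A, c B}" using V by simp
  moreover have "V - ?S \<union> ?S = V" using triplesD(1)[OF A] triplesD(1)[OF B] by blast
  ultimately have "card (c ` triples V) \<le> card {c A, c B}" by (intro card_mono) auto
  then show ?thesis using AB by simp
next
  case False
  then have const: "c e = c f" if "e \<in> triples V" "f \<in> triples V" for e f
    using disjoint_triples_connected[OF V _ that] by blast
  obtain e where "e \<in> triples V" using triple_supersetE[of "{}" V] V by auto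
  then have "c ` triples V \<subseteq> {c e}" using const by blast
  then have "card (c ` triples V) \<le> card {c e}" by (intro card_mono) auto
  then show ?thesis by simp
qed

text \<open>Disjoint edges are complementary here. If some complementary pair has two colours, there
  are no others; if none has, every colour occurs on an edge through a fixed vertex
  \<open>v\<close>, and there are \<open>5 choose 2\<close> of these.\<close>

lemma messy_free_six_colours:
  assumes V: "card V = 6" and free: "messy_free c V"
  shows "card (c ` triples V) \<le> 10"
proof (cases "\<exists>A\<in>triples V. \<exists>B\<in>triples V. A \<inter> B = {} \<and> c A \<noteq> c B")
  case True
  then obtain A B where A: "A \<in> triples V" and B: "B \<in> triples V" and AB: "A \<inter> B = {}" "c A \<noteq> c B"
    by blast
  have finV: "finite V" using V by (simp add: card_ge_0_finite)
  have "card (A \<union> B) = 6" using triplesD[OF A] triplesD[OF B] AB by (simp add: card_Un_disjoint)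
  then have "A \<union> B = V" using V finV triplesD(1)[OF A] triplesD(1)[OF B] by (intro card_subset_eq) auto
  then have "c ` triples V \<subseteq> {c A, c B}" using messy_six[OF free A B AB] by auto
  then have "card (c ` triples V) \<le> card {c A, c B}" by (intro card_mono) auto
  then show ?thesis using AB by simp
next
  case False
  have finV: "finite V" using V by (simp add: card_ge_0_finite)
  have "V \<noteq> {}" using V by auto
  then obtain v where v: "v \<in> V" by blast
  let ?P = "{e \<in> triples V. v \<in> e}"
  have "c e \<in> c ` ?P" if e: "e \<in> triples V" for e
  proof (cases "v \<in> e")
    case False
    have "card (V - e) = 3" using V triplesD[OF e] by (simp add: card_Diff_subset)
    then have "V - e \<in> triples V" "v \<in> V - e" using v False by (auto simp: triples_def)
    moreover have "c e = c (V - e)" using \<open>\<not> (\<exists>A\<in>_. _)\<close> e calculation(1) by blast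
    ultimately show ?thesis by auto
  qed (use e in auto)
  then have "c ` triples V = c ` ?P" by blast
  also have "card (c ` ?P) \<le> card ?P" using finite_triples[OF finV] by (intro card_image_le) simp
  also have "?P = insert v ` {s. s \<subseteq> V - {v} \<and> card s = 2}"
  proof (intro equalityI subsetI)
    fix e assume "e \<in> ?P"
    then have "e - {v} \<subseteq> V - {v}" "card (e - {v}) = 2" "e = insert v (e - {v})"
      using triplesD[of e V] by auto
    then show "e \<in> insert v ` {s. s \<subseteq> V - {v} \<and> card s = 2}" by blast
  next
    fix e assume "e \<in> insert v ` {s. s \<subseteq> V - {v} \<and> card s = 2}"
    then obtain s where s: "e = insert v s" "s \<subseteq> V - {v}" "card s = 2" by blast
    then have "finite s" "v \<notin> s" by (auto simp: card_ge_0_finite)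
    then show "e \<in> ?P" using s v by (auto simp: triples_def)
  qed
  also have "card (insert v ` {s. s \<subseteq> V - {v} \<and> card s = 2}) \<le> card {s. s \<subseteq> V - {v} \<and> card s = 2}"
    using finV by (intro card_image_le) simp
  also have "\<dots> = 5 choose 2" using n_subsets[of "V - {v}" 2] finV V v by simp
  also have "\<dots> = 10" by (simp add: choose_two)
  finally show ?thesis .
qed

subsection \<open>The loose path\<close>

lemma loose_freeD:
  assumes "loose_free c V" "{a, b, p, q, r, s, t} \<subseteq> V" "distinct [a, b, p, q, r, s, t]"
  shows "c {a, b, p} = c {p, q, r} \<or> c {a, b, p} = c {r, s, t} \<or> c {p, q, r} = c {r, s, t}"
proof -
  have "\<not> distinct [c {a, b, p}, c {p, q, r}, c {r, s, t}]"
    using assms(2,3) by (intro assms(1)[unfolded loose_free_def, rule_format] conjI)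
  then show ?thesis by simp
qed

text \<open>The triple is the middle edge of a loose path whose end edges are \<open>e\<close> and
  \<open>f\<close>.\<close>

lemma loose_transversal:
  assumes free: "loose_free c V" and e: "e \<in> triples V" and f: "f \<in> triples V"
    and ef: "e \<inter> f = {}" "c e \<noteq> c f" and a: "a \<in> e" and b: "b \<in> f" and w: "w \<in> V" "w \<notin> e \<union> f"
  shows "c {a, b, w} \<in> {c e, c f}"
proof -
  obtain a2 a3 where E: "e = {a, a2, a3}" "distinct [a, a2, a3]" using triple_memE[OF e a] .
  obtain b2 b3 where F: "f = {b, b2, b3}" "distinct [b, b2, b3]" using triple_memE[OF f b] .
  have "{a2, a3, a, w, b, b2, b3} \<subseteq> V" using triplesD(1)[OF e] triplesD(1)[OF f] w E F by auto
  moreover have "distinct [a2, a3, a, w, b, b2, b3]" using E F ef(1) w(2) by auto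
  ultimately have "c {a2, a3, a} = c {a, w, b} \<or> c {a2, a3, a} = c {b, b2, b3} \<or> c {a, w, b} = c {b, b2, b3}"
    by (rule loose_freeD[OF free])
  moreover have "{a2, a3, a} = e" "{a, w, b} = {a, b, w}" "{b, b2, b3} = f" using E F by auto
  ultimately have "c e = c {a, b, w} \<or> c e = c f \<or> c {a, b, w} = c f" by metis
  then show ?thesis using ef(2) by auto
qed

text \<open>The auxiliary edges \<open>{a4, a5, a7}\<close>, \<open>{a2, a6, a7}\<close>,
  \<open>{a1, a3, a6}\<close> form a loose path. Other loose paths through them force their colours
  to be \<open>k1\<close>, \<open>k2\<close>, \<open>k3\<close>, which makes that path
  rainbow.\<close>

lemma loose_third_colour_one_zero:
  assumes free: "loose_free c V" and V: "{a1, a2, a3, a4, a5, a6, a7, a8} \<subseteq> V"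
    and dist: "distinct [a1, a2, a3, a4, a5, a6, a7, a8]"
    and k: "c {a1, a2, a3} = k1" "c {a4, a5, a6} = k2" "c {a1, a7, a8} = k3" and ne: "distinct [k1, k2, k3]"
  shows False
proof -
  note G = loose_freeD[OF free]
  have dist': "distinct [a8, a7, a6, a5, a4, a3, a2, a1]" using dist by auto
  define x where "x = c {a4, a5, a7}"
  define y where "y = c {a2, a6, a7}"
  define z where "z = c {a1, a3, a6}"
  note defs = k x_def[symmetric] y_def[symmetric] z_def[symmetric]
  \<comment> \<open>\<open>y1\<close> and \<open>y2\<close> yield \<open>y = k2\<close>; with this,
    \<open>x1\<close> and \<open>x2\<close> yield \<open>x = k1\<close>; with that,
    \<open>z1\<close> and \<open>z2\<close> yield \<open>z = k3\<close>.\<close>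
  have x1: "k1 = k3 \<or> k1 = x \<or> k3 = x"
    using G[of a2 a3 a1 a8 a7 a4 a5] V dist dist' by (simp add: insert_commute defs)
  have y1: "k1 = y \<or> k1 = k2 \<or> y = k2"
    using G[of a1 a3 a2 a7 a6 a4 a5] V dist dist' by (simp add: insert_commute defs)
  have y2: "k3 = y \<or> k3 = k2 \<or> y = k2"
    using G[of a1 a8 a7 a2 a6 a4 a5] V dist dist' by (simp add: insert_commute defs)
  have x2: "x = y \<or> x = k1 \<or> y = k1"
    using G[of a4 a5 a7 a6 a2 a1 a3] V dist dist' by (simp add: insert_commute defs)
  have z1: "k3 = z \<or> k3 = k2 \<or> z = k2"
    using G[of a7 a8 a1 a3 a6 a4 a5] V dist dist' by (simp add: insert_commute defs)
  have z2: "x = k3 \<or> x = z \<or> k3 = z"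
    using G[of a4 a5 a7 a8 a1 a6 a3] V dist dist' by (simp add: insert_commute defs)
  have "x = y \<or> x = z \<or> y = z"
    using G[of a4 a5 a7 a2 a6 a1 a3] V dist dist' by (simp add: insert_commute defs)
  then show False using x1 x2 y1 y2 z1 z2 ne by (simp, metis)
qed

text \<open>Otherwise \<open>h\<close> meets each of \<open>e\<close> and \<open>f\<close> in at
  most one vertex. If it misses both, a triple with one vertex from each of the three edges has no
  possible colour, since any two of the edges restrict it to their own colours. If it meets just
  one, the eight-vertex configuration applies; if it meets both, \<open>h\<close> is itself a
  transversal of \<open>e\<close> and \<open>f\<close>.\<close>

lemma loose_third_colour:
  assumes free: "loose_free c V" and e: "e \<in> triples V" and f: "f \<in> triples V" and h: "h \<in> triples V"
    and ef: "e \<inter> f = {}" and ne: "distinct [c e, c f, c h]"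
  shows "card (h \<inter> e) = 2 \<or> card (h \<inter> f) = 2"
proof (rule ccontr)
  assume n: "\<not> ?thesis"
  have le1: "card (h \<inter> g) = 0 \<or> card (h \<inter> g) = 1" if g: "g \<in> triples V" "card (h \<inter> g) \<noteq> 2" "c g \<noteq> c h" for g
  proof -
    have "card (h \<inter> g) \<noteq> 3"
    proof
      assume "card (h \<inter> g) = 3"
      then have "h = g" using triplesD[OF g(1)] triplesD[OF h] card_subset_eq inf_le1 inf_le2 by metis
      then show False using g by simp
    qed
    moreover have "card (h \<inter> g) \<le> 3" using triplesD[OF h] by (metis card_mono inf_le1)
    ultimately show ?thesis using g(2) by linarith
  qed
  have one_zero: False
    if e: "e \<in> triples V" and f: "f \<in> triples V" and ef: "e \<inter> f = {}" and ne: "distinct [c e, c f, c h]"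
      and cards: "card (h \<inter> e) = 1" "card (h \<inter> f) = 0" for e f
  proof -
    obtain a where a: "h \<inter> e = {a}" using cards(1) by (auto simp: card_1_singleton_iff)
    have hf: "h \<inter> f = {}" using cards(2) triplesD(3)[OF h] by simp
    obtain a2 a3 where E: "e = {a, a2, a3}" "distinct [a, a2, a3]" using triple_memE[OF e, of a] a by blast
    obtain a7 a8 where H: "h = {a, a7, a8}" "distinct [a, a7, a8]" using triple_memE[OF h, of a] a by blast
    obtain a4 a5 a6 where F: "f = {a4, a5, a6}" "distinct [a4, a5, a6]" using tripleE[OF f] .
    have V': "{a, a2, a3, a4, a5, a6, a7, a8} \<subseteq> V"
      using triplesD(1)[OF e] triplesD(1)[OF f] triplesD(1)[OF h] E F H by auto
    have "{a7, a8} \<inter> {a2, a3} = {}" using a E H by auto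
    moreover have "{a, a2, a3} \<inter> {a4, a5, a6} = {}" "{a, a7, a8} \<inter> {a4, a5, a6} = {}"
      using ef hf E F H by simp_all
    ultimately have D: "distinct [a, a2, a3, a4, a5, a6, a7, a8]" using E(2) F(2) H(2) by auto
    show False
      by (rule loose_third_colour_one_zero[OF free V' D refl refl refl]) (use ne E F H in simp)
  qed
  have c1: "card (h \<inter> e) = 0 \<or> card (h \<inter> e) = 1" using le1[OF e] n ne by simp
  have c2: "card (h \<inter> f) = 0 \<or> card (h \<inter> f) = 1" using le1[OF f] n ne by simp
  have ne_sets: "e \<noteq> {}" "f \<noteq> {}" "h \<noteq> {}" using triplesD(2)[OF e] triplesD(2)[OF f] triplesD(2)[OF h] by auto
  consider "card (h \<inter> e) = 0" "card (h \<inter> f) = 0" | "card (h \<inter> e) = 1" "card (h \<inter> f) = 0"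
    | "card (h \<inter> e) = 0" "card (h \<inter> f) = 1" | "card (h \<inter> e) = 1" "card (h \<inter> f) = 1"
    using c1 c2 by metis
  then show False
  proof cases
    case 1
    then have d: "h \<inter> e = {}" "h \<inter> f = {}" using triplesD(3)[OF h] by simp_all
    obtain a b w where abw: "a \<in> e" "b \<in> f" "w \<in> h" using ne_sets by blast
    have inV: "a \<in> V" "b \<in> V" "w \<in> V"
      using abw triplesD(1)[OF e] triplesD(1)[OF f] triplesD(1)[OF h] by auto
    have "c {a, b, w} \<in> {c e, c f}"
      using loose_transversal[OF free e f ef _ abw(1,2)] inV abw d ne by auto
    moreover have "c {a, w, b} \<in> {c e, c h}"
      using loose_transversal[OF free e h _ _ abw(1,3), of b] inV abw d ef ne by auto
    moreover have "c {b, w, a} \<in> {c f, c h}"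
      using loose_transversal[OF free f h _ _ abw(2,3), of a] inV abw d ef ne by auto
    moreover have "{a, w, b} = {a, b, w}" "{b, w, a} = {a, b, w}" by auto
    ultimately show False using ne by auto
  next
    case 2
    then show False using one_zero[OF e f ef ne] by simp
  next
    case 3
    then show False using one_zero[OF f e _ _ 3(2,1)] ef ne by (auto simp: Int_commute)
  next
    case 4
    then obtain a b where ab: "h \<inter> e = {a}" "h \<inter> f = {b}" by (auto simp: card_1_singleton_iff)
    then have abm: "a \<in> h" "b \<in> h" "a \<in> e" "b \<in> f" by auto
    obtain s t where st: "h = {a, s, t}" "distinct [a, s, t]" using triple_memE[OF h abm(1)] .
    have "a \<noteq> b" using abm ef by auto
    then obtain w where w: "h = {a, b, w}" "w \<noteq> a" "w \<noteq> b" using st abm(2) by auto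
    then have "w \<in> V" "w \<notin> e \<union> f" using ab triplesD(1)[OF h] by auto
    then have "c h \<in> {c e, c f}"
      using loose_transversal[OF free e f ef _ abm(3,4)] ne w(1) by auto
    then show False using ne by auto
  qed
qed

text \<open>A triple \<open>{a, u, w}\<close> with one vertex in each edge has the colour of
  \<open>{p, q, r}\<close> or of \<open>f\<close>. In each of the three positions of
  \<open>x\<close>, a loose path using \<open>{p, q, x}\<close> also restricts the stated triples to
  the colour of \<open>{p, q, x}\<close> or of \<open>f\<close>, so only that of \<open>f\<close> is
  left.\<close>

lemma loose_forced:
  assumes free: "loose_free c V" and e: "{p, q, r} \<in> triples V" and f: "f \<in> triples V"
    and h: "{p, q, x} \<in> triples V" and x: "x \<noteq> r" and ef: "{p, q, r} \<inter> f = {}"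
    and ne: "distinct [c {p, q, r}, c f, c {p, q, x}]" and w: "w \<in> V" "w \<notin> {p, q, r} \<union> f"
  shows "x = w \<Longrightarrow> u \<in> f \<Longrightarrow> c {r, u, w} = c f"
    and "x \<noteq> w \<Longrightarrow> x \<notin> f \<Longrightarrow> u \<in> f \<Longrightarrow> a \<in> {p, q} \<Longrightarrow> c {a, u, w} = c f"
    and "x \<in> f \<Longrightarrow> u \<in> f \<Longrightarrow> u \<noteq> x \<Longrightarrow> a \<in> {p, q, r} \<Longrightarrow> c {a, u, w} = c f"
proof -
  have D: "distinct [p, q, r]" "distinct [p, q, x]"
    using triplesD(2)[OF e] triplesD(2)[OF h] by (auto simp: card_insert_if split: if_splits)
  have inV: "p \<in> V" "q \<in> V" "r \<in> V" "x \<in> V" using triplesD(1)[OF e] triplesD(1)[OF h] by auto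
  have ef': "c {p, q, r} \<noteq> c f" and hf': "c {p, q, x} \<noteq> c f" using ne by auto
  have T: "c {a, u, w} \<in> {c {p, q, r}, c f}" if "a \<in> {p, q, r}" "u \<in> f" for a u
    using loose_transversal[OF free e f ef ef' that w] .
  {
    assume *: "x = w" "u \<in> f"
    have "{p, q, x} \<inter> f = {}" using ef w * by auto
    then have "c {x, u, r} \<in> {c {p, q, x}, c f}"
      by (rule loose_transversal[OF free h f _ hf']) (use * inV D x ef w in auto)
    moreover have "{x, u, r} = {r, u, w}" using * by auto
    ultimately show "c {r, u, w} = c f" using T[of r u] * ne by auto
  next
    assume *: "x \<noteq> w" "x \<notin> f" "u \<in> f" "a \<in> {p, q}"
    have "{p, q, x} \<inter> f = {}" using ef * by auto
    then have "c {a, u, w} \<in> {c {p, q, x}, c f}"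
      by (rule loose_transversal[OF free h f _ hf']) (use * w in auto)
    then show "c {a, u, w} = c f" using T[of a u] * ne by auto
  next
    assume *: "x \<in> f" "u \<in> f" "u \<noteq> x" "a \<in> {p, q, r}"
    have R: "c {r, v, w} = c f" if v: "v \<in> f" "v \<noteq> x" for v
    proof -
      obtain s t where st: "f = {x, s, t}" "distinct [x, s, t]" using triple_memE[OF f *(1)] .
      then obtain s where s: "f = {x, s, v}" "distinct [x, s, v]" using v by auto
      have "{p, q, x, s, v, r, w} \<subseteq> V" using inV w triplesD(1)[OF f] s by auto
      \<comment> \<open>The edges of this loose path are \<open>{p, q, x}\<close>, \<open>f\<close>
        and \<open>{v, r, w}\<close>.\<close>
      moreover have "distinct [p, q, x, s, v, r, w]" using D s ef w x by auto
      ultimately have "c {p, q, x} = c {x, s, v} \<or> c {p, q, x} = c {v, r, w} \<or> c {x, s, v} = c {v, r, w}"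
        by (rule loose_freeD[OF free])
      moreover have "{v, r, w} = {r, v, w}" by auto
      ultimately have "c {r, v, w} \<in> {c {p, q, x}, c f}" using hf' s(1) by auto
      then show ?thesis using T[of r v] v ne by auto
    qed
    show "c {a, u, w} = c f"
    proof (cases "a = r")
      case True
      then show ?thesis using R * by simp
    next
      case False
      obtain s t where st: "f = {x, s, t}" "distinct [x, s, t]" using triple_memE[OF f *(1)] .
      then obtain s where s: "f = {x, u, s}" "distinct [x, u, s]" using * by auto
      have g: "{r, s, w} \<in> triples V" using w inV triplesD(1)[OF f] s ef by (intro triplesI) auto
      have "c {r, s, w} = c f" using R s by auto
      \<comment> \<open>The triple \<open>{r, s, w}\<close> already has the colour of
        \<open>f\<close> and now takes its place; \<open>u\<close> serves as the outside
        vertex.\<close>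
      moreover have "c {a, w, u} \<in> {c {p, q, x}, c {r, s, w}}"
      proof (rule loose_transversal[OF free h g])
        show "{p, q, x} \<inter> {r, s, w} = {}" using D s w x ef by auto
        show "c {p, q, x} \<noteq> c {r, s, w}" using hf' calculation by simp
        show "u \<in> V" using * triplesD(1)[OF f] by auto
        show "u \<notin> {p, q, x} \<union> {r, s, w}" using s ef w by auto
      qed (use False * in auto)
      moreover have "{a, w, u} = {a, u, w}" by auto
      ultimately show ?thesis using T[of a u] * ne by auto
    qed
  }
qed

text \<open>Fix \<open>w\<close> outside both edges. Among the triples \<open>{a, u, w}\<close> with
  \<open>a\<close> in \<open>e\<close> and \<open>u\<close> in \<open>f\<close>, the edge
  \<open>h\<close> forces some to have the colour of \<open>f\<close>, and \<open>h'\<close> forces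
  some to have the colour of \<open>e\<close>. For most positions of \<open>x\<close> and
  \<open>y\<close> these overlap; in the two remaining ones \<open>{r, u3, w}\<close> is a
  transversal of the disjoint edges \<open>h\<close> and \<open>h'\<close>.\<close>

lemma loose_same_side:
  assumes free: "loose_free c V" and V: "finite V" "card V \<ge> 7"
    and e: "e \<in> triples V" and f: "f \<in> triples V" and ef: "e \<inter> f = {}"
    and h: "h \<in> triples V" "card (h \<inter> e) = 2" and h': "h' \<in> triples V" "card (h' \<inter> f) = 2"
    and ne: "distinct [c e, c f, c h, c h']"
  shows False
proof -
  have split: "\<exists>p q r x. g = {p, q, r} \<and> k = {p, q, x} \<and> distinct [p, q, r] \<and> x \<notin> g"
    if g: "g \<in> triples V" and k: "k \<in> triples V" and card: "card (k \<inter> g) = 2" for g k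
  proof -
    obtain p q where pq: "k \<inter> g = {p, q}" "p \<noteq> q" using card by (auto simp: card_2_iff)
    have "card (g - k) = 1" "card (k - g) = 1"
      using card triplesD[OF g] triplesD[OF k] by (simp_all add: card_Diff_subset_Int Int_commute)
    then obtain r x where rx: "g - k = {r}" "k - g = {x}" by (auto simp: card_1_singleton_iff)
    have "g = {p, q, r}" "k = {p, q, x}" "x \<notin> g" "r \<notin> k" using pq rx by blast+
    moreover from this have "distinct [p, q, r]" using pq(2) by auto
    ultimately show ?thesis by blast
  qed
  obtain p q r x where E: "e = {p, q, r}" "h = {p, q, x}" "distinct [p, q, r]" "x \<notin> e"
    using split[OF e h] by blast
  obtain u1 u2 u3 y where F: "f = {u1, u2, u3}" "h' = {u1, u2, y}" "distinct [u1, u2, u3]" "y \<notin> f"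
    using split[OF f h'] by blast
  have "card (e \<union> f) = 6" using triplesD[OF e] triplesD[OF f] ef by (simp add: card_Un_disjoint)
  then have "\<not> V \<subseteq> e \<union> f" using V card_mono[of "e \<union> f" V] triplesD(3)[OF e] triplesD(3)[OF f] by auto
  then obtain w where w: "w \<in> V" "w \<notin> e \<union> f" by blast
  define P where "P a u \<longleftrightarrow> c {a, u, w} = c f" for a u
  define Q where "Q a u \<longleftrightarrow> c {a, u, w} = c e" for a u
  have PQ: False if "P a u" "Q a u" for a u using that ne unfolding P_def Q_def by simp
  have xr: "x \<noteq> r" and yu: "y \<noteq> u3" using E F by auto
  note forced = loose_forced[OF free e[unfolded E(1)] f h(1)[unfolded E(2)] xr ef[unfolded E(1)] _ w(1) w(2)[unfolded E(1)],
      folded E(1) E(2)]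
  have ef': "f \<inter> e = {}" "w \<notin> f \<union> e" using ef w by auto
  note forced' = loose_forced[OF free f[unfolded F(1)] e h'(1)[unfolded F(2)] yu ef'(1)[unfolded F(1)] _ w(1) ef'(2)[unfolded F(1)],
      folded F(1) F(2)]
  have ne1: "distinct [c e, c f, c h]" and ne2: "distinct [c f, c e, c h']" using ne by auto
  have P1: "P r u" if "x = w" "u \<in> f" for u
    using forced(1)[OF ne1 that] unfolding P_def .
  have P2: "P a u" if "x \<noteq> w" "x \<notin> f" "u \<in> f" "a \<in> {p, q}" for a u
    using forced(2)[OF ne1 that] unfolding P_def .
  have P3: "P a u" if "x \<in> f" "u \<in> f" "u \<noteq> x" "a \<in> e" for a u
    using forced(3)[OF ne1 that] unfolding P_def .
  have Q1: "Q a u3" if "y = w" "a \<in> e" for a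
    using forced'(1)[OF ne2 that] unfolding Q_def by (simp add: insert_commute)
  have Q2: "Q a u" if "y \<noteq> w" "y \<notin> e" "a \<in> e" "u \<in> {u1, u2}" for a u
    using forced'(2)[OF ne2 that] unfolding Q_def by (simp add: insert_commute)
  have Q3: "Q a u" if "y \<in> e" "a \<in> e" "a \<noteq> y" "u \<in> f" for a u
    using forced'(3)[OF ne2 that] unfolding Q_def by (simp add: insert_commute)
  have hh': "c {s, t, v} \<in> {c h, c h'}"
    if "s \<in> h" "t \<in> h'" "v \<in> V" "v \<notin> h \<union> h'" "h \<inter> h' = {}" for s t v
    using loose_transversal[OF free h(1) h'(1) that(5) _ that(1-4)] ne by simp
  have mem: "p \<in> e" "q \<in> e" "r \<in> e" "u1 \<in> f" "u2 \<in> f" "u3 \<in> f" "p \<noteq> q" "u1 \<noteq> u2" using E F by auto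
  have inV: "r \<in> V" "u3 \<in> V" using mem triplesD(1)[OF e] triplesD(1)[OF f] by auto
  consider (xw) "x = w" | (xf) "x \<in> f" | (xo) "x \<noteq> w" "x \<notin> f" by blast
  then show False
  proof cases
    case xw
    consider "y = w" | "y \<noteq> w" "y \<notin> e" | "y \<in> e" "y \<noteq> r" | "y = r" using mem by blast
    then show False
    proof cases
      case 1
      then show False using PQ[OF P1[OF xw mem(6)] Q1] mem by blast
    next
      case 2
      then show False using PQ[OF P1[OF xw mem(4)] Q2] mem by blast
    next
      case 3
      then show False using PQ[OF P1[OF xw mem(4)] Q3] mem by blast
    next
      case 4
      \<comment> \<open>Here \<open>h = {p, q, w}\<close> and \<open>h' = {u1, u2, r}\<close>, while
        \<open>{r, u3, w}\<close> is forced to the colour of \<open>f\<close>.\<close>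
      have "h \<inter> h' = {}" "u3 \<notin> h \<union> h'" "w \<in> h" "r \<in> h'" using E F ef w xw 4 by auto
      then have "c {w, r, u3} \<in> {c h, c h'}" using hh' inV by blast
      moreover have "{w, r, u3} = {r, u3, w}" by auto
      ultimately show False using P1[OF xw mem(6)] ne unfolding P_def by auto
    qed
  next
    case xf
    consider "y = w" "x \<noteq> u3" | "y = w" "x = u3" | "y \<noteq> w" "y \<notin> e" | "y \<in> e" by blast
    then show False
    proof cases
      case 1
      then show False using PQ[OF P3[OF xf mem(6)] Q1] mem by blast
    next
      case 2
      \<comment> \<open>The mirror case: \<open>h = {p, q, u3}\<close> and
        \<open>h' = {u1, u2, w}\<close>, while \<open>{r, u3, w}\<close> is forced to the colour of
        \<open>e\<close>.\<close>
      have "h \<inter> h' = {}" "r \<notin> h \<union> h'" "u3 \<in> h" "w \<in> h'" using E F ef w 2 by auto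
      then have "c {u3, w, r} \<in> {c h, c h'}" using hh' inV by blast
      moreover have "{u3, w, r} = {r, u3, w}" by auto
      ultimately show False using Q1[OF 2(1) mem(3)] ne unfolding Q_def by auto
    next
      case 3
      obtain u where "u \<in> {u1, u2}" "u \<noteq> x" "u \<in> f" using mem by (metis insertI1 insertI2)
      then show False using PQ[OF P3 Q2] xf 3 mem by blast
    next
      case 4
      obtain u where u: "u \<noteq> x" "u \<in> f" using mem by metis
      obtain a where a: "a \<noteq> y" "a \<in> e" using mem by metis
      show False using PQ[OF P3[OF xf u(2,1) a(2)] Q3[OF 4 a(2,1) u(2)]] .
    qed
  next
    case xo
    consider "y = w" | "y \<noteq> w" "y \<notin> e" | "y \<in> e" by blast
    then show False
    proof cases
      case 1
      then show False using PQ[OF P2[OF xo mem(6)] Q1] mem by blast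
    next
      case 2
      then show False using PQ[OF P2[OF xo mem(4)] Q2] mem by blast
    next
      case 3
      obtain a where "a \<noteq> y" "a \<in> {p, q}" "a \<in> e" using mem by (metis insertI1 insertI2)
      then show False using PQ[OF P2[OF xo mem(4)] Q3] 3 mem by blast
    qed
  qed
qed

text \<open>A representative \<open>r k\<close> is a pair of vertices of \<open>e\<close>, its
  trace, plus one outside vertex \<open>x k\<close>. Representatives with different outside vertices
  have equal traces. So either all traces agree and the outside vertices tell the colours apart, or
  the outside vertex is constant and the three pairs of \<open>e\<close> do.\<close>

lemma loose_one_side_count:
  assumes free: "loose_free c V" and V: "finite V" "card V \<ge> 7" and e: "e \<in> triples V"
    and side: "\<And>h. h \<in> triples V \<Longrightarrow> c h \<notin> {k1, k2} \<Longrightarrow> card (h \<inter> e) = 2"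
  shows "card (c ` triples V - {k1, k2}) \<le> card V - 3"
proof -
  define K where "K = c ` triples V - {k1, k2}"
  define r where "r k = (SOME e. e \<in> triples V \<and> c e = k)" for k
  have r: "r k \<in> triples V" "c (r k) = k" "card (r k \<inter> e) = 2" if "k \<in> K" for k
  proof -
    show *: "r k \<in> triples V" "c (r k) = k"
      using someI_ex[of "\<lambda>e. e \<in> triples V \<and> c e = k"] that unfolding K_def r_def by auto
    show "card (r k \<inter> e) = 2" using side[OF *(1)] * that unfolding K_def by simp
  qed
  have "\<exists>x. r k - e = {x}" if "k \<in> K" for k
  proof -
    have "card (r k - e) = 1"
      using r[OF that] triplesD[OF r(1)[OF that]] by (simp add: card_Diff_subset_Int)
    then show ?thesis by (auto simp: card_1_singleton_iff)
  qed
  then obtain x where x: "\<And>k. k \<in> K \<Longrightarrow> r k - e = {x k}" by metis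
  have xV: "x k \<in> V - e" if "k \<in> K" for k using x[OF that] triplesD(1)[OF r(1)[OF that]] by blast
  have re: "r k = (r k \<inter> e) \<union> {x k}" if "k \<in> K" for k using x[OF that] by blast
  have pair: "r k \<inter> e = r l \<inter> e" if k: "k \<in> K" and l: "l \<in> K" and xne: "x k \<noteq> x l" for k l
  proof (rule ccontr)
    assume n: "r k \<inter> e \<noteq> r l \<inter> e"
    have fin: "finite (r k \<inter> e)" "finite (r l \<inter> e)" using triplesD(3)[OF e] by auto
    have "\<not> r k \<inter> e \<subseteq> r l \<inter> e" using n card_subset_eq[OF fin(2)] r(3)[OF k] r(3)[OF l] by metis
    then obtain b where b: "b \<in> r k" "b \<in> e" "b \<notin> r l" by blast
    have "card (r k \<inter> e - {b}) = 1" using b fin r(3)[OF k] by simp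
    then obtain a where a: "r k \<inter> e - {b} = {a}" by (auto simp: card_1_singleton_iff)
    have rk: "r k \<inter> e = {a, b}" "a \<noteq> b" using a b by blast+
    have "card (e - {b}) = 2" using b triplesD[OF e] by simp
    moreover have "r l \<inter> e \<subseteq> e - {b}" using b by blast
    ultimately have rl: "r l \<inter> e = e - {b}" using r(3)[OF l] triplesD(3)[OF e] by (metis card_subset_eq finite_Diff)
    have "a \<in> e - {b}" using rk by blast
    then have "a \<in> r l \<inter> e" using rl by blast
    obtain d where d: "e - {b} = {a, d}" "a \<noteq> d"
    proof -
      have "card (e - {b} - {a}) = 1" using \<open>card (e - {b}) = 2\<close> \<open>a \<in> e - {b}\<close> by simp
      then obtain d where "e - {b} - {a} = {d}" by (auto simp: card_1_singleton_iff)
      then show thesis using that[of d] \<open>a \<in> e - {b}\<close> by blast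
    qed
    have E: "e = {a, b, d}" "b \<noteq> d" using d b by blast+
    have Rk: "r k = {a, b, x k}" using re[OF k] rk by auto
    have Rl: "r l = {a, d, x l}" using re[OF l] rl d by auto
    \<comment> \<open>Seven vertices leave two fresh ones \<open>s\<close>, \<open>t\<close>. In the
      loose path \<open>r l\<close>, \<open>r k\<close>, \<open>{x k, s, t}\<close> the last edge
      must repeat colour \<open>k\<close> or \<open>l\<close>, although it misses
      \<open>e\<close>.\<close>
    let ?U = "{a, b, d, x k, x l}"
    have "card ?U \<le> 5" using card_length[of "[a, b, d, x k, x l]"] by simp
    then have "2 \<le> card (V - ?U)" using V(2) diff_card_le_card_Diff[of ?U V] by simp
    then obtain S where S: "S \<subseteq> V - ?U" "card S = 2" using obtain_subset_with_card_n by metis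
    then obtain s t where st: "S = {s, t}" "s \<noteq> t" by (auto simp: card_2_iff)
    have stV: "s \<in> V" "t \<in> V" "s \<notin> ?U" "t \<notin> ?U" using S st by auto
    have xkl: "x k \<in> V" "x l \<in> V" "x k \<notin> e" "x l \<notin> e" using xV[OF k] xV[OF l] by auto
    have "{d, x l, a, b, x k, s, t} \<subseteq> V" using stV xkl E triplesD(1)[OF e] by auto
    moreover have "distinct [d, x l, a, b, x k, s, t]"
      using stV xkl E(1) \<open>b \<noteq> d\<close> \<open>a \<noteq> d\<close> \<open>a \<noteq> b\<close> \<open>s \<noteq> t\<close> xne by auto
    ultimately have "c {d, x l, a} = c {a, b, x k} \<or> c {d, x l, a} = c {x k, s, t} \<or> c {a, b, x k} = c {x k, s, t}"
      by (rule loose_freeD[OF free])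
    moreover have "{d, x l, a} = r l" using Rl by auto
    ultimately have "c {x k, s, t} \<in> {k, l}" using Rk r(2)[OF k] r(2)[OF l] xne by auto
    then have "c {x k, s, t} \<notin> {k1, k2}" using k l unfolding K_def by auto
    moreover have "{x k, s, t} \<in> triples V" using stV xkl \<open>s \<noteq> t\<close> by (intro triplesI) auto
    ultimately have "card ({x k, s, t} \<inter> e) = 2" by (intro side)
    moreover have "{x k, s, t} \<inter> e = {}" using stV xkl E by auto
    ultimately show False by simp
  qed
  have inj: "k = l" if "k \<in> K" "l \<in> K" "r k \<inter> e = r l \<inter> e" "x k = x l" for k l
    using re[OF that(1)] re[OF that(2)] that(3,4) r(2)[OF that(1)] r(2)[OF that(2)] by metis
  have cardVe: "card (V - e) = card V - 3" using triplesD[OF e] by (simp add: card_Diff_subset)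
  show ?thesis
  proof (cases "\<exists>i\<in>K. \<exists>j\<in>K. x i \<noteq> x j")
    case True
    then obtain i j where ij: "i \<in> K" "j \<in> K" "x i \<noteq> x j" by blast
    \<comment> \<open>\<open>x k\<close> differs from \<open>x i\<close> or from \<open>x j\<close>,
      and \<open>r i\<close> and \<open>r j\<close> have the same trace.\<close>
    have "r k \<inter> e = r i \<inter> e" if "k \<in> K" for k
      using pair[OF that ij(1)] pair[OF that ij(2)] pair[OF ij] ij(3) by metis
    then have "inj_on x K" using inj by (intro inj_onI) metis
    then have "card K \<le> card (V - e)" using xV V by (intro card_inj_on_le[of x]) auto
    then show ?thesis unfolding K_def cardVe .
  next
    case False
    then have "inj_on (\<lambda>k. r k \<inter> e) K" using inj by (intro inj_onI) metis
    then have "card K \<le> card {s. s \<subseteq> e \<and> card s = 2}"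
      using r(3) triplesD(3)[OF e] by (intro card_inj_on_le[of "\<lambda>k. r k \<inter> e"]) auto
    also have "\<dots> = 3 choose 2" using n_subsets[OF triplesD(3)[OF e], of 2] triplesD(2)[OF e] by simp
    also have "\<dots> = 3" by (simp add: choose_two)
    finally show ?thesis using V unfolding K_def by simp
  qed
qed

text \<open>With \<open>card V\<close> colours, at least \<open>card V - 2\<close> remain besides
  those of the disjoint edges \<open>e\<close> and \<open>f\<close>, more than one side alone can
  account for. Hence both sides occur, and choosing representatives of different colours on opposite
  sides contradicts \<open>loose_same_side\<close>.\<close>

lemma loose_free_card_colours:
  assumes free: "loose_free c V" and V: "finite V" "card V \<ge> 7"
  shows "card (c ` triples V) \<le> card V - 1"
proof (rule ccontr)
  assume "\<not> ?thesis"
  then have many: "card (c ` triples V) \<ge> card V" by simp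
  have "\<exists>e\<in>triples V. \<exists>f\<in>triples V. e \<inter> f = {} \<and> c e \<noteq> c f"
  proof (rule ccontr)
    assume "\<not> ?thesis"
    then have const: "c e = c f" if "e \<in> triples V" "f \<in> triples V" for e f
      using disjoint_triples_connected[OF V _ that] by blast
    obtain e where "e \<in> triples V" using triple_supersetE[of "{}" V] V by auto
    then have "c ` triples V \<subseteq> {c e}" using const by blast
    then have "card (c ` triples V) \<le> card {c e}" by (intro card_mono) auto
    then show False using many V by simp
  qed
  then obtain e f where e: "e \<in> triples V" and f: "f \<in> triples V" and ef: "e \<inter> f = {}" "c e \<noteq> c f"
    by blast
  have fe: "f \<inter> e = {}" "c f \<noteq> c e" using ef by auto
  let ?K = "c ` triples V - {c e, c f}"
  have K: "card ?K \<ge> card V - 2"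
    using many diff_card_le_card_Diff[of "{c e, c f}" "c ` triples V"] ef(2) by simp
  have not_one_side: "\<exists>h\<in>triples V. c h \<notin> {c e, c f} \<and> card (h \<inter> g) \<noteq> 2" if "g \<in> triples V" for g
    using loose_one_side_count[OF free V that, of "c e" "c f"] K V by force
  have side: "card (h \<inter> e) = 2 \<or> card (h \<inter> f) = 2" if "h \<in> triples V" "c h \<notin> {c e, c f}" for h
    using loose_third_colour[OF free e f that(1) ef(1)] that(2) ef(2) by auto
  \<comment> \<open>Some edge of a further colour does not have two vertices in \<open>f\<close>, so
    it has two in \<open>e\<close>; the roles are exchanged for \<open>h'\<close>.\<close>
  obtain h where h: "h \<in> triples V" "c h \<notin> {c e, c f}" "card (h \<inter> e) = 2"
    using not_one_side[OF f] side by blast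
  obtain h' where h': "h' \<in> triples V" "c h' \<notin> {c e, c f}" "card (h' \<inter> f) = 2"
    using not_one_side[OF e] side by blast
  \<comment> \<open>\<open>h\<close> and \<open>h'\<close> may have the same colour. An edge
    \<open>g\<close> of yet another colour is paired with whichever of them lies on the other
    side.\<close>
  have "\<not> ?K \<subseteq> {c h, c h'}"
  proof
    assume "?K \<subseteq> {c h, c h'}"
    then have "card ?K \<le> card {c h, c h'}" by (intro card_mono) auto
    also have "\<dots> \<le> 2" by (simp add: card_insert_if)
    finally show False using K V by simp
  qed
  then obtain g where g: "g \<in> triples V" "c g \<notin> {c e, c f}" "c g \<notin> {c h, c h'}" by blast
  show False
  proof (cases "card (g \<inter> e) = 2")
    case True
    then show False
      using loose_same_side[OF free V e f ef(1) g(1) True h'(1,3)] g h' ef by auto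
  next
    case False
    then have "card (g \<inter> f) = 2" using side g by blast
    then show False
      using loose_same_side[OF free V e f ef(1) h(1,3) g(1)] g h ef by auto
  qed
qed

subsection \<open>Extremal colourings\<close>

definition block :: "nat \<Rightarrow> nat set" where
  "block i = {3 * i, 3 * i + 1, 3 * i + 2}"

text \<open>Only the block containing the least vertex can equal an edge. Blocks have private
  colours, which \<open>Suc\<close> keeps apart from the common colour 0.\<close>

definition block_colouring :: "nat set \<Rightarrow> nat" where
  "block_colouring e = (if e = block (Min e div 3) then Suc (Min e div 3) else 0)"

lemma block_colouring_block: "block_colouring (block i) = Suc i"
proof -
  have "Min (block i) = 3 * i" by (simp add: block_def)
  then show ?thesis by (simp add: block_colouring_def)
qed

text \<open>All three edges of a tight path contain its middle vertex \<open>p\<close>, which lies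
  in a single block, so at most one positive colour occurs among them.\<close>

lemma tight_free_block_colouring: "tight_free block_colouring V"
  unfolding tight_free_def
proof (intro allI impI notI)
  fix a b p q r :: nat
  assume *: "distinct [block_colouring {a, b, p}, block_colouring {b, p, q}, block_colouring {p, q, r}]"
  have "block_colouring e = block_colouring f"
    if pef: "p \<in> e" "p \<in> f" and nz: "block_colouring e \<noteq> 0" "block_colouring f \<noteq> 0" for e f
  proof -
    obtain i j where ij: "e = block i" "f = block j"
      using nz by (metis block_colouring_def)
    then have "p div 3 = i" "p div 3 = j" using pef by (auto simp: block_def)
    then show ?thesis using ij by simp
  qed
  from this[of "{a, b, p}" "{b, p, q}"] this[of "{a, b, p}" "{p, q, r}"] this[of "{b, p, q}" "{p, q, r}"]
  show False using * by (simp, metis gr0I)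
qed

lemma card_block_colouring:
  assumes "n \<ge> 5"
  shows "n div 3 + 1 \<le> card (block_colouring ` triples {..<n})"
proof -
  have "{..n div 3} \<subseteq> block_colouring ` triples {..<n}"
  proof
    fix k assume k: "k \<in> {..n div 3}"
    show "k \<in> block_colouring ` triples {..<n}"
    proof (cases k)
      case 0
      have "Min {0, 1, 3 :: nat} = 0" by simp
      moreover have "3 \<notin> block 0" by (simp add: block_def)
      then have "{0, 1, 3} \<noteq> block 0" by blast
      ultimately have "block_colouring {0, 1, 3} = 0" by (simp add: block_colouring_def)
      moreover have "{0, 1, 3} \<in> triples {..<n}" using assms by (intro triplesI) auto
      ultimately show ?thesis using 0 by (metis image_eqI)
    next
      case (Suc i)
      then have "block i \<in> triples {..<n}"
        using k unfolding block_def by (intro triplesI) auto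
      then show ?thesis using Suc block_colouring_block by (metis image_eqI)
    qed
  qed
  then have "card {..n div 3} \<le> card (block_colouring ` triples {..<n})"
    by (intro card_mono finite_imageI finite_triples) auto
  then show ?thesis by simp
qed

lemma ar_tight_path:
  assumes "n \<ge> 5"
  shows "ar n tight_path = n div 3 + 2"
proof -
  have "ar n tight_path = Suc (n div 3 + 1)"
  proof (rule ar_eqI[OF _ card_block_colouring[OF assms]])
    show "\<exists>C. is_copy_in C tight_path (complete_three_graph n) \<and> rainbow c C"
      if "n div 3 + 1 < card (c ` triples {..<n})" for c :: "nat set \<Rightarrow> nat"
      unfolding rainbow_tight_iff using tight_free_card_colours[of "{..<n}" c] that assms by auto
    show "\<not> (\<exists>C. is_copy_in C tight_path (complete_three_graph n) \<and> rainbow block_colouring C)"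
      unfolding rainbow_tight_iff by (simp add: tight_free_block_colouring)
  qed
  then show ?thesis by simp
qed

text \<open>An edge and its complement in six vertices get the same number: the binary code of
  whichever of them contains 0.\<close>

definition complement_colouring :: "nat set \<Rightarrow> nat" where
  "complement_colouring e = (\<Sum>x\<in>(if 0 \<in> e then e else {..<6} - e). 2 ^ x)"

text \<open>On six vertices the first and last edges of a messy path are complementary.\<close>

lemma messy_free_complement_colouring: "messy_free complement_colouring {..<6}"
  unfolding messy_free_def
proof (intro allI impI, elim conjE)
  fix a b p q r s :: nat
  assume V: "{a, b, p, q, r, s} \<subseteq> {..<6}" and dist: "distinct [a, b, p, q, r, s]"
  have "card {a, b, p, q, r, s} = 6" using distinct_card[OF dist] by simp
  then have eq: "{a, b, p, q, r, s} = {..<6}" using V by (intro card_subset_eq) auto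
  then have "{..<6} - {a, b, p} = {q, r, s}" "{..<6} - {q, r, s} = {a, b, p}" using dist by auto
  moreover have "0 \<in> {a, b, p, q, r, s}" using eq by simp
  then have "0 \<in> {a, b, p} \<longleftrightarrow> 0 \<notin> {q, r, s}" using dist by auto
  ultimately have "complement_colouring {a, b, p} = complement_colouring {q, r, s}"
    unfolding complement_colouring_def by (simp only: if_True if_False split: if_split) simp
  then show "\<not> distinct [complement_colouring {a, b, p}, complement_colouring {b, p, q}, complement_colouring {q, r, s}]"
    by simp
qed

lemma card_complement_colouring: "10 \<le> card (complement_colouring ` triples {..<6})"
proof -
  have mem: "1 + 2 ^ i + 2 ^ j \<in> complement_colouring ` triples {..<6}" if "0 < i" "i < j" "j < 6" for i j
  proof (rule image_eqI)
    show "1 + 2 ^ i + 2 ^ j = complement_colouring {0, i, j}"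
      using that by (simp add: complement_colouring_def)
    show "{0, i, j} \<in> triples {..<6}" using that by (intro triplesI) auto
  qed
  \<comment> \<open>These are the binary codes of the ten triples \<open>{0, i, j}\<close>, in the
    order of the instances of \<open>mem\<close>.\<close>
  have "{7, 11, 19, 35, 13, 21, 37, 25, 41, 49} \<subseteq> complement_colouring ` triples {..<6}"
    using mem[of 1 2] mem[of 1 3] mem[of 1 4] mem[of 1 5] mem[of 2 3] mem[of 2 4] mem[of 2 5]
      mem[of 3 4] mem[of 3 5] mem[of 4 5] by simp
  then have "card {7, 11, 19, 35, 13, 21, 37, 25, 41, 49 :: nat} \<le> card (complement_colouring ` triples {..<6})"
    by (intro card_mono finite_imageI finite_triples) auto
  then show ?thesis by simp
qed

lemma ar_messy_path_six: "ar 6 messy_path = 11"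
proof -
  have "ar 6 messy_path = Suc 10"
  proof (rule ar_eqI[OF _ card_complement_colouring])
    show "\<exists>C. is_copy_in C messy_path (complete_three_graph 6) \<and> rainbow c C"
      if "10 < card (c ` triples {..<6})" for c :: "nat set \<Rightarrow> nat"
      unfolding rainbow_messy_iff using messy_free_six_colours[of "{..<6}" c] that by auto
    show "\<not> (\<exists>C. is_copy_in C messy_path (complete_three_graph 6) \<and> rainbow complement_colouring C)"
      unfolding rainbow_messy_iff by (simp add: messy_free_complement_colouring)
  qed
  then show ?thesis by simp
qed

lemma ar_messy_path:
  assumes "n \<ge> 7"
  shows "ar n messy_path = 3"
proof -
  \<comment> \<open>Two colours cannot make three edges rainbow, so any colouring with exactly two
    colours serves.\<close>
  define c0 :: "nat set \<Rightarrow> nat" where "c0 e = (if 0 \<in> e then 1 else 0)" for e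
  have "ar n messy_path = Suc 2"
  proof (rule ar_eqI)
    show "\<exists>C. is_copy_in C messy_path (complete_three_graph n) \<and> rainbow c C"
      if "2 < card (c ` triples {..<n})" for c :: "nat set \<Rightarrow> nat"
      unfolding rainbow_messy_iff using messy_free_two_colours[of "{..<n}" c] that assms by auto
    have "{0, 1, 2} \<in> triples {..<n}" "{1, 2, 3} \<in> triples {..<n}" using assms by (auto intro!: triplesI)
    moreover have "c0 {0, 1, 2} = 1" "c0 {1, 2, 3} = 0" by (simp_all add: c0_def)
    ultimately have "{0, 1} \<subseteq> c0 ` triples {..<n}" by (metis empty_subsetI image_eqI insert_subset)
    then have "card {0, 1 :: nat} \<le> card (c0 ` triples {..<n})"
      by (intro card_mono finite_imageI finite_triples) auto
    then show "2 \<le> card (c0 ` triples {..<n})" by simp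
    have "messy_free c0 {..<n}" unfolding messy_free_def c0_def by simp
    then show "\<not> (\<exists>C. is_copy_in C messy_path (complete_three_graph n) \<and> rainbow c0 C)"
      unfolding rainbow_messy_iff by simp
  qed
  then show ?thesis by simp
qed

text \<open>In a triple containing 0 and 1 the maximum is the third vertex, so these edges have
  different positive colours.\<close>

definition pair_colouring :: "nat set \<Rightarrow> nat" where
  "pair_colouring e = (if {0, 1} \<subseteq> e then Max e else 0)"

text \<open>Two edges of a loose path share at most one vertex, so at most one of the three contains
  both 0 and 1; the other two have colour 0.\<close>

lemma loose_free_pair_colouring: "loose_free pair_colouring V"
  unfolding loose_free_def
proof (intro allI impI, elim conjE)
  fix a b p q r s t :: nat
  assume dist: "distinct [a, b, p, q, r, s, t]"
  have zero: "pair_colouring e = 0 \<or> pair_colouring f = 0" if "\<not> {0, 1} \<subseteq> e \<inter> f" for e f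
    using that by (auto simp: pair_colouring_def)
  have "{a, b, p} \<inter> {p, q, r} \<subseteq> {p}" "{a, b, p} \<inter> {r, s, t} \<subseteq> {}" "{p, q, r} \<inter> {r, s, t} \<subseteq> {r}"
    using dist by auto
  moreover have "\<not> {0, 1} \<subseteq> {x}" for x :: nat by auto
  ultimately have "\<not> {0, 1} \<subseteq> {a, b, p} \<inter> {p, q, r}" "\<not> {0, 1} \<subseteq> {a, b, p} \<inter> {r, s, t}"
    "\<not> {0, 1} \<subseteq> {p, q, r} \<inter> {r, s, t}" by (meson empty_subsetI order_trans)+
  then show "\<not> distinct [pair_colouring {a, b, p}, pair_colouring {p, q, r}, pair_colouring {r, s, t}]"
    using zero[of "{a, b, p}" "{p, q, r}"] zero[of "{a, b, p}" "{r, s, t}"] zero[of "{p, q, r}" "{r, s, t}"]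
    by (simp only: distinct.simps list.set insert_iff empty_iff) metis
qed

lemma card_pair_colouring:
  assumes "n \<ge> 7"
  shows "n - 1 \<le> card (pair_colouring ` triples {..<n})"
proof -
  \<comment> \<open>The third vertices are at least 2, which gives \<open>n - 2\<close> colours
    besides 0.\<close>
  have "insert 0 {2..<n} \<subseteq> pair_colouring ` triples {..<n}"
  proof
    fix k assume k: "k \<in> insert 0 {2..<n}"
    show "k \<in> pair_colouring ` triples {..<n}"
    proof (cases "k = 0")
      case True
      have "{2, 3, 4} \<in> triples {..<n}" using assms by (intro triplesI) auto
      moreover have "pair_colouring {2, 3, 4} = 0" by (simp add: pair_colouring_def)
      ultimately show ?thesis using True by (metis image_eqI)
    next
      case False
      then have "{0, 1, k} \<in> triples {..<n}" using k by (intro triplesI) auto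
      moreover have "pair_colouring {0, 1, k} = k" using k False by (simp add: pair_colouring_def)
      ultimately show ?thesis by (metis image_eqI)
    qed
  qed
  then have "card (insert 0 {2..<n}) \<le> card (pair_colouring ` triples {..<n})"
    by (intro card_mono finite_imageI finite_triples) auto
  then show ?thesis by simp
qed

lemma ar_loose_path:
  assumes "n \<ge> 7"
  shows "ar n loose_path = n"
proof -
  have "ar n loose_path = Suc (n - 1)"
  proof (rule ar_eqI[OF _ card_pair_colouring[OF assms]])
    show "\<exists>C. is_copy_in C loose_path (complete_three_graph n) \<and> rainbow c C"
      if "n - 1 < card (c ` triples {..<n})" for c :: "nat set \<Rightarrow> nat"
      unfolding rainbow_loose_iff using loose_free_card_colours[of c "{..<n}"] that assms by auto
    show "\<not> (\<exists>C. is_copy_in C loose_path (complete_three_graph n) \<and> rainbow pair_colouring C)"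
      unfolding rainbow_loose_iff by (simp add: loose_free_pair_colouring)
  qed
  then show ?thesis using assms by simp
qed

theorem theorem1p12:
  shows "(\<forall>n::nat. n \<ge> 5 \<longrightarrow> ar n tight_path = n div 3 + 2) \<and>
         (ar 6 messy_path = 11 \<and> (\<forall>n::nat. n \<ge> 7 \<longrightarrow> ar n messy_path = 3)) \<and>
         (\<forall>n::nat. n \<ge> 7 \<longrightarrow> ar n loose_path = n)"
  using ar_tight_path ar_messy_path_six ar_messy_path ar_loose_path by blast

end
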